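(* Let $\Bbbk$ be a field of characteristic $0$, let $(P,\cdot,[-,-])$ be a finite-dimensional Poisson algebra over $\Bbbk$, let $(B=\bigoplus_{i\in\mathbb Z}B_i,\circ_B,\omega)$ be a quadratic $\mathbb Z$-graded perm algebra, and let $(P\otimes B,\circ,\ast)$ be the induced $\mathbb Z$-graded DPP algebra, with $(p_1\otimes b_1)\circ(p_2\otimes b_2)=(p_1p_2)\otimes(b_1\circ_B b_2)$ and $(p_1\otimes b_1)\ast(p_2\otimes b_2)=[p_1,p_2]\otimes(b_1\circ_B b_2)$. Suppose that $r=\sum_i x_i\otimes y_i\in P\otimes P$ is a solution of the PoiYBE in $(P,\cdot,[-,-])$. Then $$\widehat r=\sum_i\sum_{j\in\Omega}(x_i\otimes e_j)\otimes(y_i\otimes f_j)\in(P\otimes B)\,\hat\otimes\,(P\otimes B)$$ is a completed solution of the DPYBE in $(P\otimes B,\circ,\ast)$, where $\{e_j\}_{j\in\Omega}$ is a homogeneous basis of $B$ and $\{f_j\}_{j\in\Omega}$ is the homogeneous dual basis with respect to $\omega$, i.e. $\omega(f_i,e_j)=\delta_{ij}$. Moreover: (i) $\widehat r$ is symmetric (i.e. $\hat\tau(\widehat r)=\widehat r$) if $r$ is skew-symmetric (i.e. $\tau(r)=-r$); (ii) $\widehat r-\hat\tau(\widehat r)$ is DP-invariant if $r+\tau(r)$ is Poi-invariant.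
   Context: **Poisson side.** A Poisson algebra $(P,\cdot,[-,-])$ is a commutative associative (not necessarily unital) algebra and a Lie algebra with $[p_1,p_2p_3]=[p_1,p_2]p_3+p_2[p_1,p_3]$. Let $u(p)q=pq$, $\mathrm{ad}(p)q=[p,q]$, $\tau(x\otimes y)=y\otimes x$. For $r=\sum_i x_i\otimes y_i\in P\otimes P$ the (classical) Poisson Yang-Baxter equation (PoiYBE) is the pair $\mathbf A_r=\sum_{i,j}(x_ix_j\otimes y_i\otimes y_j+x_i\otimes x_j\otimes y_iy_j-x_j\otimes x_iy_j\otimes y_i)=0$, $\mathbf C_r=\sum_{i,j}([x_i,x_j]\otimes y_i\otimes y_j+x_i\otimes x_j\otimes[y_i,y_j]+x_i\otimes[y_i,x_j]\otimes y_j)=0$. An element $s\in P\otimes P$ is Poi-invariant if $(\mathrm{id}\otimes u(p)-u(p)\otimes\mathrm{id})(s)=0$ and $(\mathrm{id}\otimes\mathrm{ad}(p)+\mathrm{ad}(p)\otimes\mathrm{id})(s)=0$ for all $p\in P$. **Perm and DPP algebras.** A perm algebra $(B,\circ)$ satisfies $b_1\circ(b_2\circ b_3)=(b_1\circ b_2)\circ b_3=(b_2\circ b_1)\circ b_3$; a (left) Leibniz algebra satisfies $a_1\ast(a_2\ast a_3)=(a_1\ast a_2)\ast a_3+a_2\ast(a_1\ast a_3)$. A dual pre-Poisson (DPP) algebra $(A,\circ,\ast)$ is a perm algebra and a Leibniz algebra with $(a_1\circ a_2)\ast a_3=a_1\circ(a_2\ast a_3)+a_2\circ(a_1\ast a_3)$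 and $(a_1\ast a_2)\circ a_3=a_1\ast(a_2\circ a_3)-a_2\circ(a_1\ast a_3)=-(a_2\ast a_1)\circ a_3$. It is $\mathbb Z$-graded if $A=\bigoplus_iA_i$ with every $A_i$ finite-dimensional, $A_i\circ A_j\subseteq A_{i+j}$, $A_i\ast A_j\subseteq A_{i+j}$; similarly for perm algebras. $(P\otimes B)_i=P\otimes B_i$. A quadratic $\mathbb Z$-graded perm algebra $(B,\circ_B,\omega)$ is a $\mathbb Z$-graded perm algebra with a skew-symmetric nondegenerate bilinear form $\omega$ such that $\omega(b_1\circ_B b_2,b_3)=\omega(b_1,b_2\circ_B b_3-b_3\circ_B b_2)$ and, for some $m\in\mathbb Z$, $\omega(B_i,B_j)=0$ whenever $i+j+m\neq0$. **Completed tensors and DPYBE.** For $\mathbb Z$-graded $U,V$, $U\hat\otimes V=\prod_{i,j}U_i\otimes V_j$, whose elements are written as formal sums; similarly for three factors; $f\hat\otimes g$ and the flip $\hat\tau$ are defined termwise. For a $\mathbb Z$-graded DPP algebra $A$ write $L(a)b=a\circ b$, $R(a)b=b\circ a$, $\tilde L(a)b=a\ast b$, $\tilde R(a)b=b\ast a$. An element $s\in A\hat\otimes A$ is DP-invariant if for all $a\in A$: $(\mathrm{id}\hat\otimes R(a)+(R-L)(a)\hat\otimes\mathrm{id})(s)=0$ and $((\tilde L+\tilde R)(a)\hat\otimes\mathrm{id}-\mathrm{id}\hat\otimes\tilde R(a))(s)=0$. Writing $s=\sum_\alpha x_\alpha\otimes y_\alpha$ as a formal sum of homogeneous pure tensors,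 $s$ is a completed solution of the DPYBE if, in $A\hat\otimes A\hat\otimes A$, $\sum_{\alpha,\beta}\big(x_\alpha\otimes(y_\alpha\circ x_\beta)\otimes y_\beta-x_\alpha\otimes x_\beta\otimes(y_\alpha\circ y_\beta)+(x_\alpha\circ x_\beta)\otimes y_\alpha\otimes y_\beta-(x_\alpha\circ x_\beta)\otimes y_\beta\otimes y_\alpha\big)=0$ and $\sum_{\alpha,\beta}\big((x_\alpha\ast x_\beta)\otimes y_\alpha\otimes y_\beta-x_\alpha\otimes(y_\alpha\ast x_\beta)\otimes y_\beta-x_\beta\otimes(x_\alpha\ast y_\beta)\otimes y_\alpha+x_\beta\otimes x_\alpha\otimes(y_\alpha\ast y_\beta)\big)=0$. *)

theory Defs
  imports Complex_Main "HOL-Library.Function_Algebras" "HOL-Library.Groups_Big_Fun"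
begin

section \<open>Multilinear maps on subspaces\<close>

text \<open>
  A vector space over a field is given by a scalar multiplication on a type (library locale
  \<^locale>\<open>vector_space\<close>), possibly together with a subspace of that type.
\<close>

definition linear_on ::
  "('k::field \<Rightarrow> 'a::ab_group_add \<Rightarrow> 'a) \<Rightarrow> 'a set \<Rightarrow> ('k \<Rightarrow> 'c::ab_group_add \<Rightarrow> 'c) \<Rightarrow> ('a \<Rightarrow> 'c) \<Rightarrow> bool"
  where "linear_on s V z f \<longleftrightarrow>
    (\<forall>x\<in>V. \<forall>y\<in>V. f (x + y) = f x + f y) \<and> (\<forall>c. \<forall>x\<in>V. f (s c x) = z c (f x))"

definition bilinear_on ::
  "('k::field \<Rightarrow> 'a::ab_group_add \<Rightarrow> 'a) \<Rightarrow> 'a set \<Rightarrow> ('k \<Rightarrow> 'b::ab_group_add \<Rightarrow> 'b) \<Rightarrow> 'b set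
    \<Rightarrow> ('k \<Rightarrow> 'c::ab_group_add \<Rightarrow> 'c) \<Rightarrow> ('a \<Rightarrow> 'b \<Rightarrow> 'c) \<Rightarrow> bool"
  where "bilinear_on s V t W z h \<longleftrightarrow>
    (\<forall>x\<in>V. linear_on t W z (h x)) \<and> (\<forall>y\<in>W. linear_on s V z (\<lambda>x. h x y))"

definition trilinear_on ::
  "('k::field \<Rightarrow> 'a::ab_group_add \<Rightarrow> 'a) \<Rightarrow> 'a set \<Rightarrow> ('k \<Rightarrow> 'c::ab_group_add \<Rightarrow> 'c)
    \<Rightarrow> ('a \<Rightarrow> 'a \<Rightarrow> 'a \<Rightarrow> 'c) \<Rightarrow> bool"
  where "trilinear_on s V z h \<longleftrightarrow>
    (\<forall>x\<in>V. \<forall>y\<in>V. linear_on s V z (\<lambda>w. h w x y) \<and> linear_on s V z (\<lambda>w. h x w y)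
      \<and> linear_on s V z (h x y))"


section \<open>Tensor products\<close>

text \<open>
  The tensor product of two vector spaces \<open>V\<close> and \<open>W\<close> over the field \<open>'k\<close> is realised inside the
  dual of the space of bilinear forms on \<open>V \<times> W\<close>: the pure tensor of \<open>x\<close> and \<open>y\<close> is evaluation of
  bilinear forms at \<open>(x, y)\<close>, and the tensor product is the span of the pure tensors. Functionals are
  extended by 0 to functions that are not bilinear forms. Lemmas \<open>bilinear_on_tens\<close> and
  \<open>tens_universal\<close> below give the universal property.
\<close>

type_synonym ('k, 'a, 'b) tensor = "('a \<Rightarrow> 'b \<Rightarrow> 'k) \<Rightarrow> 'k"
type_synonym ('k, 'a) tensor3 = "('a \<Rightarrow> 'a \<Rightarrow> 'a \<Rightarrow> 'k) \<Rightarrow> 'k"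

definition fscale :: "'k::field \<Rightarrow> ('z \<Rightarrow> 'k) \<Rightarrow> ('z \<Rightarrow> 'k)"
  where "fscale c u = (\<lambda>\<phi>. c * u \<phi>)"

definition tens ::
  "('k::field \<Rightarrow> 'a::ab_group_add \<Rightarrow> 'a) \<Rightarrow> 'a set \<Rightarrow> ('k \<Rightarrow> 'b::ab_group_add \<Rightarrow> 'b) \<Rightarrow> 'b set
    \<Rightarrow> 'a \<Rightarrow> 'b \<Rightarrow> ('k, 'a, 'b) tensor"
  where "tens s V t W x y = (\<lambda>\<phi>. if bilinear_on s V t W (*) \<phi> then \<phi> x y else 0)"

definition tens3 ::
  "('k::field \<Rightarrow> 'a::ab_group_add \<Rightarrow> 'a) \<Rightarrow> 'a set \<Rightarrow> 'a \<Rightarrow> 'a \<Rightarrow> 'a \<Rightarrow> ('k, 'a) tensor3"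
  where "tens3 s V x y z = (\<lambda>\<Phi>. if trilinear_on s V (*) \<Phi> then \<Phi> x y z else 0)"

definition tensor_space ::
  "('k::field \<Rightarrow> 'a::ab_group_add \<Rightarrow> 'a) \<Rightarrow> 'a set \<Rightarrow> ('k \<Rightarrow> 'b::ab_group_add \<Rightarrow> 'b) \<Rightarrow> 'b set
    \<Rightarrow> ('k, 'a, 'b) tensor set"
  where "tensor_space s V t W = module.span fscale {tens s V t W x y | x y. x \<in> V \<and> y \<in> W}"

text \<open>
  The linear map \<open>f \<otimes> g\<close> for endomorphisms \<open>f\<close> of \<open>V\<close> and \<open>g\<close> of \<open>W\<close> (lemma \<open>tensor_map_tens\<close>),
  and the flip (lemma \<open>tensor_flip_tens\<close>).
\<close>

definition tensor_map ::
  "('k::field \<Rightarrow> 'a::ab_group_add \<Rightarrow> 'a) \<Rightarrow> 'a set \<Rightarrow> ('k \<Rightarrow> 'b::ab_group_add \<Rightarrow> 'b) \<Rightarrow> 'b set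
    \<Rightarrow> ('a \<Rightarrow> 'a) \<Rightarrow> ('b \<Rightarrow> 'b) \<Rightarrow> ('k, 'a, 'b) tensor \<Rightarrow> ('k, 'a, 'b) tensor"
  where "tensor_map s V t W f g u =
    (\<lambda>\<phi>. if bilinear_on s V t W (*) \<phi> then u (\<lambda>x y. \<phi> (f x) (g y)) else 0)"

definition tensor_flip :: "('k, 'a, 'b) tensor \<Rightarrow> ('k, 'b, 'a) tensor"
  where "tensor_flip u = (\<lambda>\<phi>. u (\<lambda>x y. \<phi> y x))"

definition tensor3_map ::
  "('k::field \<Rightarrow> 'a::ab_group_add \<Rightarrow> 'a) \<Rightarrow> 'a set \<Rightarrow> ('a \<Rightarrow> 'a) \<Rightarrow> ('a \<Rightarrow> 'a) \<Rightarrow> ('a \<Rightarrow> 'a)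
    \<Rightarrow> ('k, 'a) tensor3 \<Rightarrow> ('k, 'a) tensor3"
  where "tensor3_map s V f g h u =
    (\<lambda>\<Phi>. if trilinear_on s V (*) \<Phi> then u (\<lambda>x y z. \<Phi> (f x) (g y) (h z)) else 0)"

text \<open>
  For \<open>F\<close> linear in each of its four arguments, \<open>tensor_lift2 F\<close> is the bilinear map on pairs of
  2-tensors with \<open>(x \<otimes> y, x' \<otimes> y') \<mapsto> F x y x' y'\<close>, so that
  \<open>(\<Sum>\<^sub>i x\<^sub>i \<otimes> y\<^sub>i, \<Sum>\<^sub>j x'\<^sub>j \<otimes> y'\<^sub>j) \<mapsto> \<Sum>\<^sub>i\<^sub>,\<^sub>j F x\<^sub>i y\<^sub>i x'\<^sub>j y'\<^sub>j\<close> (lemma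
  \<open>subspace_pair.tensor_lift2_sum\<close>).
  Its values lie in a space of functionals.
\<close>

definition tensor_lift2 ::
  "('a \<Rightarrow> 'b \<Rightarrow> 'a \<Rightarrow> 'b \<Rightarrow> ('z \<Rightarrow> 'k)) \<Rightarrow> ('k, 'a, 'b) tensor \<Rightarrow> ('k, 'a, 'b) tensor \<Rightarrow> ('z \<Rightarrow> 'k)"
  where "tensor_lift2 F u v = (\<lambda>\<Phi>. u (\<lambda>x y. v (\<lambda>x' y'. F x y x' y' \<Phi>)))"


section \<open>Poisson algebras\<close>

locale poisson_algebra = vector_space scale
  for scale :: "'k::field \<Rightarrow> 'p::ab_group_add \<Rightarrow> 'p" +
  fixes mul :: "'p \<Rightarrow> 'p \<Rightarrow> 'p" and br :: "'p \<Rightarrow> 'p \<Rightarrow> 'p"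
  assumes mul_bilinear: "bilinear_on scale UNIV scale UNIV scale mul"
    and mul_commute: "mul p q = mul q p"
    and mul_assoc: "mul (mul p q) r = mul p (mul q r)"
    and br_bilinear: "bilinear_on scale UNIV scale UNIV scale br"
    and br_self: "br p p = 0"
    and br_jacobi: "br p (br q r) + br q (br r p) + br r (br p q) = 0"
    and br_mul: "br p (mul q r) = mul (br p q) r + mul q (br p r)"
begin

abbreviation ptens3 :: "'p \<Rightarrow> 'p \<Rightarrow> 'p \<Rightarrow> ('k, 'p) tensor3"
  where "ptens3 \<equiv> tens3 scale UNIV"

abbreviation pmap :: "('p \<Rightarrow> 'p) \<Rightarrow> ('p \<Rightarrow> 'p) \<Rightarrow> ('k, 'p, 'p) tensor \<Rightarrow> ('k, 'p, 'p) tensor"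
  where "pmap \<equiv> tensor_map scale UNIV scale UNIV"

definition poiybe_A :: "('k, 'p, 'p) tensor \<Rightarrow> ('k, 'p) tensor3"
  where "poiybe_A r = tensor_lift2 (\<lambda>x y x' y'.
    ptens3 (mul x x') y y' + ptens3 x x' (mul y y') - ptens3 x' (mul x y') y) r r"

definition poiybe_C :: "('k, 'p, 'p) tensor \<Rightarrow> ('k, 'p) tensor3"
  where "poiybe_C r = tensor_lift2 (\<lambda>x y x' y'.
    ptens3 (br x x') y y' + ptens3 x x' (br y y') + ptens3 x (br y x') y') r r"

definition poiybe_solution :: "('k, 'p, 'p) tensor \<Rightarrow> bool"
  where "poiybe_solution r \<longleftrightarrow> poiybe_A r = 0 \<and> poiybe_C r = 0"

definition poi_invariant :: "('k, 'p, 'p) tensor \<Rightarrow> bool"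
  where "poi_invariant s \<longleftrightarrow> (\<forall>p.
    pmap id (mul p) s - pmap (mul p) id s = 0 \<and>
    pmap id (br p) s + pmap (br p) id s = 0)"

end


section \<open>Graded spaces and completed tensor products\<close>

text \<open>
  A \<open>\<int>\<close>-graded vector space with finite-dimensional homogeneous components \<open>G i\<close>. The graded space
  itself is the (internal) direct sum \<open>total\<close>, which may be a proper subspace of the ambient type.
  \<^const>\<open>Sum_any\<close> is the sum of a family over its support, provided that the support is finite.
\<close>

locale graded_space = vector_space scale
  for scale :: "'k::field \<Rightarrow> 'a::ab_group_add \<Rightarrow> 'a" +
  fixes G :: "int \<Rightarrow> 'a set"
  assumes subspace_G: "subspace (G i)"
    and finite_dim_G: "\<exists>F. finite F \<and> span F = G i"
    and direct_G: "finite {i. c i \<noteq> 0} \<Longrightarrow> (\<And>i. c i \<in> G i) \<Longrightarrow> Sum_any c = 0 \<Longrightarrow> c i = 0"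
begin

definition total :: "'a set"
  where "total = span (\<Union>i. G i)"

definition component :: "int \<Rightarrow> 'a \<Rightarrow> 'a"
  where "component i a = (THE c. (\<forall>j. c j \<in> G j) \<and> finite {j. c j \<noteq> 0} \<and> a = Sum_any c) i"

text \<open>
  Elements of the completed tensor square are families \<open>s\<close> with \<open>s i j \<in> G i \<otimes> G j\<close>; over a
  field, \<open>G i \<otimes> G j\<close> is a subspace of \<open>total \<otimes> total\<close>.
\<close>

definition completed_tensor :: "(int \<Rightarrow> int \<Rightarrow> ('k, 'a, 'a) tensor) set"
  where "completed_tensor = {s. \<forall>i j.
    s i j \<in> module.span fscale {tens scale total scale total x y | x y. x \<in> G i \<and> y \<in> G j}}"

text \<open>
  The termwise action of \<open>f \<otimes> g\<close>, where \<open>f\<close> and \<open>g\<close> need not preserve degrees: the component of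
  degree \<open>(i, j)\<close> collects the contributions of all components \<open>s p q\<close>.
\<close>

definition completed_map ::
  "('a \<Rightarrow> 'a) \<Rightarrow> ('a \<Rightarrow> 'a) \<Rightarrow> (int \<Rightarrow> int \<Rightarrow> ('k, 'a, 'a) tensor) \<Rightarrow> (int \<Rightarrow> int \<Rightarrow> ('k, 'a, 'a) tensor)"
  where "completed_map f g s = (\<lambda>i j. Sum_any (\<lambda>(p, q).
    tensor_map scale total scale total (component i \<circ> f) (component j \<circ> g) (s p q)))"

text \<open>
  For \<open>s\<close> written as a formal sum of homogeneous pure tensors \<open>x\<^sub>\<alpha> \<otimes> y\<^sub>\<alpha>\<close>, this says that
  \<open>\<Sum>\<^sub>\<alpha>\<^sub>,\<^sub>\<beta> F x\<^sub>\<alpha> y\<^sub>\<alpha> x\<^sub>\<beta> y\<^sub>\<beta>\<close> is a well-defined formal sum in the completed tensor cube and equals 0: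
  in each degree \<open>(i, j, k)\<close>, only finitely many pairs of components of \<open>s\<close> contribute, and
  the contributions add up to 0.
\<close>

definition completed_sum_vanishes ::
  "('a \<Rightarrow> 'a \<Rightarrow> 'a \<Rightarrow> 'a \<Rightarrow> ('k, 'a) tensor3) \<Rightarrow> (int \<Rightarrow> int \<Rightarrow> ('k, 'a, 'a) tensor) \<Rightarrow> bool"
  where "completed_sum_vanishes F s \<longleftrightarrow> (\<forall>i j k.
    let t = (\<lambda>(p, q, p', q').
      tensor3_map scale total (component i) (component j) (component k)
        (tensor_lift2 F (s p q) (s p' q')))
    in finite {d. t d \<noteq> 0} \<and> Sum_any t = 0)"

end

definition completed_flip ::
  "(int \<Rightarrow> int \<Rightarrow> ('k, 'a, 'b) tensor) \<Rightarrow> (int \<Rightarrow> int \<Rightarrow> ('k, 'b, 'a) tensor)"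
  where "completed_flip s = (\<lambda>i j. tensor_flip (s j i))"


section \<open>Quadratic graded perm algebras\<close>

locale graded_perm_algebra = graded_space scale G
  for scale :: "'k::field \<Rightarrow> 'b::ab_group_add \<Rightarrow> 'b" and G :: "int \<Rightarrow> 'b set" +
  fixes circ :: "'b \<Rightarrow> 'b \<Rightarrow> 'b"
  assumes total_UNIV: "total = UNIV"
    and circ_bilinear: "bilinear_on scale UNIV scale UNIV scale circ"
    and circ_assoc: "circ a (circ b c) = circ (circ a b) c"
    and circ_perm: "circ (circ a b) c = circ (circ b a) c"
    and circ_graded: "a \<in> G i \<Longrightarrow> b \<in> G j \<Longrightarrow> circ a b \<in> G (i + j)"

locale quadratic_graded_perm_algebra = graded_perm_algebra scale G circ
  for scale :: "'k::field \<Rightarrow> 'b::ab_group_add \<Rightarrow> 'b" and G :: "int \<Rightarrow> 'b set"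
    and circ :: "'b \<Rightarrow> 'b \<Rightarrow> 'b" +
  fixes \<omega> :: "'b \<Rightarrow> 'b \<Rightarrow> 'k"
  assumes \<omega>_bilinear: "bilinear_on scale UNIV scale UNIV (*) \<omega>"
    and \<omega>_skew: "\<omega> a b = - \<omega> b a"
    and \<omega>_nondegenerate: "(\<And>b. \<omega> a b = 0) \<Longrightarrow> a = 0"
    and \<omega>_invariant: "\<omega> (circ a b) c = \<omega> a (circ b c - circ c b)"
    and \<omega>_graded: "\<exists>m. \<forall>i j. i + j + m \<noteq> 0 \<longrightarrow> (\<forall>a\<in>G i. \<forall>b\<in>G j. \<omega> a b = 0)"
begin

definition homogeneous_basis :: "'j set \<Rightarrow> ('j \<Rightarrow> 'b) \<Rightarrow> bool"
  where "homogeneous_basis \<Omega> e \<longleftrightarrow>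
    inj_on e \<Omega> \<and> independent (e ` \<Omega>) \<and> span (e ` \<Omega>) = UNIV \<and> (\<forall>j\<in>\<Omega>. \<exists>d. e j \<in> G d)"

definition dual_homogeneous_bases :: "'j set \<Rightarrow> ('j \<Rightarrow> 'b) \<Rightarrow> ('j \<Rightarrow> 'b) \<Rightarrow> bool"
  where "dual_homogeneous_bases \<Omega> e f \<longleftrightarrow>
    homogeneous_basis \<Omega> e \<and> homogeneous_basis \<Omega> f \<and>
    (\<forall>i\<in>\<Omega>. \<forall>j\<in>\<Omega>. \<omega> (f i) (e j) = (if i = j then 1 else 0))"

end


section \<open>Graded dual pre-Poisson algebras\<close>

locale graded_dpp_algebra = graded_space scale G
  for scale :: "'k::field \<Rightarrow> 'a::ab_group_add \<Rightarrow> 'a" and G :: "int \<Rightarrow> 'a set" +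
  fixes circ :: "'a \<Rightarrow> 'a \<Rightarrow> 'a" and ast :: "'a \<Rightarrow> 'a \<Rightarrow> 'a"
  assumes circ_bilinear: "bilinear_on scale total scale total scale circ"
    and ast_bilinear: "bilinear_on scale total scale total scale ast"
    and circ_graded: "a \<in> G i \<Longrightarrow> b \<in> G j \<Longrightarrow> circ a b \<in> G (i + j)"
    and ast_graded: "a \<in> G i \<Longrightarrow> b \<in> G j \<Longrightarrow> ast a b \<in> G (i + j)"
    and circ_assoc: "\<lbrakk>a \<in> total; b \<in> total; c \<in> total\<rbrakk> \<Longrightarrow> circ a (circ b c) = circ (circ a b) c"
    and circ_perm: "\<lbrakk>a \<in> total; b \<in> total; c \<in> total\<rbrakk> \<Longrightarrow> circ (circ a b) c = circ (circ b a) c"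
    and ast_leibniz: "\<lbrakk>a \<in> total; b \<in> total; c \<in> total\<rbrakk> \<Longrightarrow>
      ast a (ast b c) = ast (ast a b) c + ast b (ast a c)"
    and circ_ast: "\<lbrakk>a \<in> total; b \<in> total; c \<in> total\<rbrakk> \<Longrightarrow>
      ast (circ a b) c = circ a (ast b c) + circ b (ast a c)"
    and ast_circ: "\<lbrakk>a \<in> total; b \<in> total; c \<in> total\<rbrakk> \<Longrightarrow>
      circ (ast a b) c = ast a (circ b c) - circ b (ast a c)"
    and ast_circ_skew: "\<lbrakk>a \<in> total; b \<in> total; c \<in> total\<rbrakk> \<Longrightarrow>
      circ (ast a b) c = - circ (ast b a) c"
begin

abbreviation atens3 :: "'a \<Rightarrow> 'a \<Rightarrow> 'a \<Rightarrow> ('k, 'a) tensor3"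
  where "atens3 \<equiv> tens3 scale total"

text \<open>
  In the notation \<open>L\<close>, \<open>R\<close> for left and right multiplication by \<open>a\<close> with respect to \<open>circ\<close> and
  \<open>L'\<close>, \<open>R'\<close> with respect to \<open>ast\<close>, the conditions are \<open>(id \<otimes> R + (R - L) \<otimes> id) s = 0\<close> and
  \<open>((L' + R') \<otimes> id - id \<otimes> R') s = 0\<close>.
\<close>

definition dp_invariant :: "(int \<Rightarrow> int \<Rightarrow> ('k, 'a, 'a) tensor) \<Rightarrow> bool"
  where "dp_invariant s \<longleftrightarrow> s \<in> completed_tensor \<and> (\<forall>a\<in>total.
    completed_map id (\<lambda>b. circ b a) s + completed_map (\<lambda>b. circ b a - circ a b) id s = 0 \<and>
    completed_map (\<lambda>b. ast a b + ast b a) id s - completed_map id (\<lambda>b. ast b a) s = 0)"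

definition completed_dpybe_solution :: "(int \<Rightarrow> int \<Rightarrow> ('k, 'a, 'a) tensor) \<Rightarrow> bool"
  where "completed_dpybe_solution s \<longleftrightarrow> s \<in> completed_tensor \<and>
    completed_sum_vanishes (\<lambda>x y x' y'.
      atens3 x (circ y x') y' - atens3 x x' (circ y y')
      + atens3 (circ x x') y y' - atens3 (circ x x') y' y) s \<and>
    completed_sum_vanishes (\<lambda>x y x' y'.
      atens3 (ast x x') y y' - atens3 x (ast y x') y'
      - atens3 x' (ast x y') y + atens3 x' x (ast y y')) s"

end


section \<open>The induced dual pre-Poisson algebra\<close>

definition induced_grading ::
  "('k::field \<Rightarrow> 'p::ab_group_add \<Rightarrow> 'p) \<Rightarrow> ('k \<Rightarrow> 'b::ab_group_add \<Rightarrow> 'b) \<Rightarrow> (int \<Rightarrow> 'b set)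
    \<Rightarrow> int \<Rightarrow> ('k, 'p, 'b) tensor set"
  where "induced_grading sP sB G i =
    module.span fscale {tens sP UNIV sB UNIV p b | p b. b \<in> G i}"

text \<open>\<open>(p \<otimes> b, p' \<otimes> b') \<mapsto> m p p' \<otimes> c b b'\<close>, see lemma \<open>induced_setting.induced_product_tens\<close>.\<close>

definition induced_product ::
  "('k::field \<Rightarrow> 'p::ab_group_add \<Rightarrow> 'p) \<Rightarrow> ('k \<Rightarrow> 'b::ab_group_add \<Rightarrow> 'b)
    \<Rightarrow> ('p \<Rightarrow> 'p \<Rightarrow> 'p) \<Rightarrow> ('b \<Rightarrow> 'b \<Rightarrow> 'b)
    \<Rightarrow> ('k, 'p, 'b) tensor \<Rightarrow> ('k, 'p, 'b) tensor \<Rightarrow> ('k, 'p, 'b) tensor"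
  where "induced_product sP sB m c =
    tensor_lift2 (\<lambda>p b p' b'. tens sP UNIV sB UNIV (m p p') (c b b'))"

text \<open>
  The formal sum of the \<open>(x\<^sub>i \<otimes> e\<^sub>j) \<otimes> (y\<^sub>i \<otimes> f\<^sub>j)\<close>: the component of degree \<open>(k, l)\<close> collects the
  terms with \<open>e\<^sub>j\<close> of degree \<open>k\<close> and \<open>f\<^sub>j\<close> of degree \<open>l\<close>. They are finitely many, see lemma
  \<open>quadratic_graded_perm_algebra.finite_degree_terms\<close>.
\<close>

definition induced_r ::
  "('k::field \<Rightarrow> 'p::ab_group_add \<Rightarrow> 'p) \<Rightarrow> ('k \<Rightarrow> 'b::ab_group_add \<Rightarrow> 'b) \<Rightarrow> (int \<Rightarrow> 'b set)
    \<Rightarrow> 'i set \<Rightarrow> ('i \<Rightarrow> 'p) \<Rightarrow> ('i \<Rightarrow> 'p) \<Rightarrow> 'j set \<Rightarrow> ('j \<Rightarrow> 'b) \<Rightarrow> ('j \<Rightarrow> 'b)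
    \<Rightarrow> int \<Rightarrow> int \<Rightarrow> ('k, ('k, 'p, 'b) tensor, ('k, 'p, 'b) tensor) tensor"
  where "induced_r sP sB G I x y \<Omega> e f = (\<lambda>k l.
    \<Sum>i\<in>I. \<Sum>j\<in>{j\<in>\<Omega>. e j \<in> G k \<and> f j \<in> G l}.
      tens fscale (tensor_space sP UNIV sB UNIV) fscale (tensor_space sP UNIV sB UNIV)
        (tens sP UNIV sB UNIV (x i) (e j)) (tens sP UNIV sB UNIV (y i) (f j)))"


section \<open>The constructions have the expected properties\<close>

text \<open>
  Nothing in this section is needed to state the theorem. It establishes the universal property of
  the tensor product, the values of the maps above on (sums of) pure tensors, the decomposition of an
  element into its homogeneous components, and that the induced structure is a graded dual
  pre-Poisson algebra.
\<close>

lemma vector_space_fscale: "vector_space (fscale :: 'k::field \<Rightarrow> ('z \<Rightarrow> 'k) \<Rightarrow> ('z \<Rightarrow> 'k))"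
  by unfold_locales (auto simp: fscale_def plus_fun_def algebra_simps fun_eq_iff)

interpretation fvs: vector_space "fscale :: 'k::field \<Rightarrow> ('z \<Rightarrow> 'k) \<Rightarrow> ('z \<Rightarrow> 'k)"
  by (rule vector_space_fscale)

lemma bilinear_on_tens:
  assumes "vector_space s" "module.subspace s V" "vector_space t" "module.subspace t W"
  shows "bilinear_on s V t W fscale (tens s V t W)"
proof -
  interpret a: vector_space s by fact
  interpret b: vector_space t by fact
  show ?thesis
    by (auto simp: bilinear_on_def linear_on_def tens_def fscale_def fun_eq_iff)
qed

lemma tensor_space_induct [consumes 3, case_names zero add]:
  assumes "vector_space s" "module.subspace s V"
    and "u \<in> tensor_space s V t W"
    and zero: "P 0"
    and add: "\<And>x y u. x \<in> V \<Longrightarrow> y \<in> W \<Longrightarrow> u \<in> tensor_space s V t W \<Longrightarrow> P u \<Longrightarrow> P (tens s V t W x y + u)"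
  shows "P u"
proof -
  interpret a: vector_space s by fact
  have "P u \<and> u \<in> tensor_space s V t W"
    using assms(3) unfolding tensor_space_def
  proof (induction rule: fvs.span_induct_alt)
    case base
    show ?case using zero fvs.span_zero by blast
  next
    case (step c w v)
    then obtain x y where w: "w = tens s V t W x y" "x \<in> V" "y \<in> W" by auto
    have eq: "fscale c w = tens s V t W (s c x) y"
      using w by (auto simp: fscale_def tens_def bilinear_on_def linear_on_def fun_eq_iff)
    have sx: "s c x \<in> V" using w assms(2) by (simp add: a.subspace_scale)
    have "tens s V t W (s c x) y \<in> fvs.span {tens s V t W x y | x y. x \<in> V \<and> y \<in> W}"
      using sx w by (intro fvs.span_base) auto
    then show ?case
      using add[OF sx w(3), of v] step fvs.span_add unfolding eq tensor_space_def by blast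
  qed
  then show ?thesis by simp
qed

lemma tens_in_tensor_space: "x \<in> V \<Longrightarrow> y \<in> W \<Longrightarrow> tens s V t W x y \<in> tensor_space s V t W"
  unfolding tensor_space_def by (rule fvs.span_base) auto

theorem tens_universal:
  assumes "vector_space s" "module.subspace s V" "vector_space t" "module.subspace t W"
    and "vector_space z" and h: "bilinear_on s V t W z h"
  shows "\<exists>g. Vector_Spaces.linear fscale z g \<and> (\<forall>x\<in>V. \<forall>y\<in>W. g (tens s V t W x y) = h x y)"
proof -
  interpret c: vector_space z by fact
  interpret fc: vector_space_pair "fscale :: 'a \<Rightarrow> ((_ \<Rightarrow> _ \<Rightarrow> 'a) \<Rightarrow> 'a) \<Rightarrow> _" z by unfold_locales
  interpret ck: vector_space_pair z "(*) :: 'a \<Rightarrow> 'a \<Rightarrow> 'a"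
    by unfold_locales (auto simp: algebra_simps)
  let ?T = "{tens s V t W x y | x y. x \<in> V \<and> y \<in> W}"
  obtain S where S: "S \<subseteq> ?T" "fvs.independent S" "?T \<subseteq> fvs.span S"
    by (rule fvs.maximal_independent_subset[of ?T])
  have "\<forall>b\<in>S. \<exists>p. fst p \<in> V \<and> snd p \<in> W \<and> b = tens s V t W (fst p) (snd p)"
    using S(1) by fastforce
  then obtain p where p: "\<And>b. b \<in> S \<Longrightarrow> fst (p b) \<in> V \<and> snd (p b) \<in> W
      \<and> b = tens s V t W (fst (p b)) (snd (p b))" by metis
  obtain g where g: "Vector_Spaces.linear fscale z g" "\<forall>b\<in>S. g b = h (fst (p b)) (snd (p b))"
    using fc.linear_independent_extend[OF S(2), of "\<lambda>b. h (fst (p b)) (snd (p b))"] by auto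
  interpret g: Vector_Spaces.linear fscale z g by fact
  have "g (tens s V t W x y) = h x y" if xy: "x \<in> V" "y \<in> W" for x y
  proof (rule ccontr)
    assume neq: "g (tens s V t W x y) \<noteq> h x y"
    define d where "d = g (tens s V t W x y) - h x y"
    have "d \<noteq> 0" using neq by (simp add: d_def)
    then have "c.independent {d}" by (simp add: c.dependent_single)
    then obtain l where l: "Vector_Spaces.linear z (*) l" "l d = 1"
      using ck.linear_independent_extend[of "{d}" "\<lambda>_. 1"] by auto
    interpret l: Vector_Spaces.linear z "(*)" l by fact
    let ?\<phi> = "\<lambda>x y. l (h x y)"
    have bl: "bilinear_on s V t W (*) ?\<phi>"
      using h by (auto simp: bilinear_on_def linear_on_def l.add l.scale)
    have "tens s V t W x y \<in> fvs.span S" using S(3) xy by auto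
    have key: "l (g u) = u ?\<phi>" if "u \<in> fvs.span S" for u
      using that
    proof (induction rule: fvs.span_induct_alt)
      case base
      then show ?case by (metis g.zero l.zero zero_fun_apply)
    next
      case (step c w v)
      have "w ?\<phi> = ?\<phi> (fst (p w)) (snd (p w))"
        using p[OF step(1)] bl by (metis (no_types, lifting) tens_def)
      moreover have "l (g (fscale c w + v)) = c * l (g w) + l (g v)"
        by (simp only: g.add l.add g.scale l.scale)
      moreover have "(fscale c w + v) ?\<phi> = c * w ?\<phi> + v ?\<phi>"
        by (simp add: fscale_def)
      ultimately show ?case using step g(2) by metis
    qed
    then have "l (g (tens s V t W x y)) = tens s V t W x y ?\<phi>"
      using key \<open>tens s V t W x y \<in> fvs.span S\<close> by blast
    also have "\<dots> = l (h x y)" using bl by (simp add: tens_def)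
    finally have "l d = 0" by (simp add: d_def l.diff)
    then show False using l(2) by simp
  qed
  then show ?thesis using g(1) by auto
qed


lemma tensor_map_tens:
  assumes "linear_on s V s f" "linear_on t W t g" "f ` V \<subseteq> V" "g ` W \<subseteq> W" "x \<in> V" "y \<in> W"
  shows "tensor_map s V t W f g (tens s V t W x y) = tens s V t W (f x) (g y)"
proof -
  have "bilinear_on s V t W (*) (\<lambda>x y. \<phi> (f x) (g y))" if "bilinear_on s V t W (*) \<phi>" for \<phi>
    using that assms by (auto simp: bilinear_on_def linear_on_def image_subset_iff)
  then show ?thesis by (auto simp: tensor_map_def tens_def fun_eq_iff)
qed

lemma tensor_map_add: "tensor_map s V t W f g (u + v) = tensor_map s V t W f g u + tensor_map s V t W f g v"
  by (auto simp: tensor_map_def fun_eq_iff)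

lemma tensor_flip_tens: "tensor_flip (tens s V t W x y) = tens t W s V y x"
  by (auto simp: tensor_flip_def tens_def bilinear_on_def fun_eq_iff)

lemma tensor_flip_add: "tensor_flip (u + v) = tensor_flip u + tensor_flip v"
  by (auto simp: tensor_flip_def fun_eq_iff)

lemma tensor3_map_tens3:
  assumes "linear_on s V s f" "linear_on s V s g" "linear_on s V s h"
    "f ` V \<subseteq> V" "g ` V \<subseteq> V" "h ` V \<subseteq> V" "x \<in> V" "y \<in> V" "z \<in> V"
  shows "tensor3_map s V f g h (tens3 s V x y z) = tens3 s V (f x) (g y) (h z)"
proof -
  have "trilinear_on s V (*) (\<lambda>x y z. \<Phi> (f x) (g y) (h z))" if "trilinear_on s V (*) \<Phi>" for \<Phi>
    using that assms by (auto simp: trilinear_on_def linear_on_def image_subset_iff)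
  then show ?thesis by (auto simp: tensor3_map_def tens3_def fun_eq_iff)
qed

definition quadrilinear_on ::
  "('k::field \<Rightarrow> 'a::ab_group_add \<Rightarrow> 'a) \<Rightarrow> 'a set \<Rightarrow> ('k \<Rightarrow> 'b::ab_group_add \<Rightarrow> 'b) \<Rightarrow> 'b set
    \<Rightarrow> ('a \<Rightarrow> 'b \<Rightarrow> 'a \<Rightarrow> 'b \<Rightarrow> ('z \<Rightarrow> 'k)) \<Rightarrow> bool"
  where "quadrilinear_on s V t W F \<longleftrightarrow> (\<forall>x\<in>V. \<forall>y\<in>W.
    bilinear_on s V t W fscale (F x y) \<and> bilinear_on s V t W fscale (\<lambda>x' y'. F x' y' x y))"

lemma bilinear_on_cong:
  assumes "vector_space s" "module.subspace s V" "vector_space t" "module.subspace t W"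
    and "\<And>x y. x \<in> V \<Longrightarrow> y \<in> W \<Longrightarrow> h x y = h' x y"
  shows "bilinear_on s V t W z h = bilinear_on s V t W z h'"
proof -
  interpret a: vector_space s by fact
  interpret b: vector_space t by fact
  have *: "x + y \<in> V" "s c x \<in> V" if "x \<in> V" "y \<in> V" for x y c
    using that assms(2) a.subspace_add a.subspace_scale by blast+
  have **: "x + y \<in> W" "t c x \<in> W" if "x \<in> W" "y \<in> W" for x y c
    using that assms(4) b.subspace_add b.subspace_scale by blast+
  show ?thesis
    using * ** assms(5) by (simp add: bilinear_on_def linear_on_def)
qed

locale subspace_pair =
  fixes s :: "'k::field \<Rightarrow> 'a::ab_group_add \<Rightarrow> 'a" and V
    and t :: "'k \<Rightarrow> 'b::ab_group_add \<Rightarrow> 'b" and W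
  assumes vs: "vector_space s" "module.subspace s V" "vector_space t" "module.subspace t W"
begin

abbreviation T :: "('k, 'a, 'b) tensor set"
  where "T \<equiv> tensor_space s V t W"

lemma T_add: "u \<in> T \<Longrightarrow> v \<in> T \<Longrightarrow> u + v \<in> T"
  unfolding tensor_space_def by (rule fvs.span_add)

lemma T_zero: "0 \<in> T"
  unfolding tensor_space_def by (rule fvs.span_zero)

lemma tensor_additive:
  assumes "u \<in> T" "bilinear_on s V t W (*) \<phi>" "bilinear_on s V t W (*) \<psi>"
  shows "u (\<lambda>x y. \<phi> x y + \<psi> x y) = u \<phi> + u \<psi>"
proof -
  have "bilinear_on s V t W (*) (\<lambda>x y. \<phi> x y + \<psi> x y)"
    using assms(2,3) by (simp add: bilinear_on_def linear_on_def algebra_simps)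
  note bl = this
  show ?thesis
    using vs(1,2) assms(1)
    by (induction rule: tensor_space_induct) (simp_all add: tens_def bl assms(2,3) algebra_simps)
qed

lemma tensor_homogeneous:
  assumes "u \<in> T" "bilinear_on s V t W (*) \<phi>"
  shows "u (\<lambda>x y. c * \<phi> x y) = c * u \<phi>"
proof -
  have "bilinear_on s V t W (*) (\<lambda>x y. c * \<phi> x y)"
    using assms(2) by (simp add: bilinear_on_def linear_on_def algebra_simps)
  note bl = this
  show ?thesis
    using vs(1,2) assms(1)
    by (induction rule: tensor_space_induct) (simp_all add: tens_def bl assms(2) algebra_simps)
qed

lemma quadrilinear_on_12:
  "quadrilinear_on s V t W F \<Longrightarrow> x' \<in> V \<Longrightarrow> y' \<in> W \<Longrightarrow>
    bilinear_on s V t W (*) (\<lambda>x y. F x y x' y' \<Phi>)"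
  by (auto simp: quadrilinear_on_def bilinear_on_def linear_on_def fscale_def)

lemma quadrilinear_on_34:
  "quadrilinear_on s V t W F \<Longrightarrow> x \<in> V \<Longrightarrow> y \<in> W \<Longrightarrow>
    bilinear_on s V t W (*) (\<lambda>x' y'. F x y x' y' \<Phi>)"
  by (auto simp: quadrilinear_on_def bilinear_on_def linear_on_def fscale_def)

lemma tens_apply: "bilinear_on s V t W (*) \<phi> \<Longrightarrow> tens s V t W x y \<phi> = \<phi> x y"
  by (simp add: tens_def)

lemma bilinear_on_tens_apply:
  assumes F: "quadrilinear_on s V t W F" and "x' \<in> V" "y' \<in> W"
  shows "bilinear_on s V t W (*) (\<lambda>x y. tens s V t W x' y' (\<lambda>x' y'. F x y x' y' \<Phi>))"
  by (subst bilinear_on_cong[OF vs, where h' = "\<lambda>x y. F x y x' y' \<Phi>"])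
    (simp_all add: tens_apply quadrilinear_on_34[OF F] quadrilinear_on_12[OF F] assms(2,3))

lemma tensor_lift2_tens:
  assumes F: "quadrilinear_on s V t W F" and "x \<in> V" "y \<in> W" "x' \<in> V" "y' \<in> W"
  shows "tensor_lift2 F (tens s V t W x y) (tens s V t W x' y') = F x y x' y'"
  by (rule ext)
    (simp add: tensor_lift2_def tens_apply bilinear_on_tens_apply quadrilinear_on_34[OF F] assms)

lemma bilinear_on_tensor_apply:
  assumes F: "quadrilinear_on s V t W F" and "v \<in> T"
  shows "bilinear_on s V t W (*) (\<lambda>x y. v (\<lambda>x' y'. F x y x' y' \<Phi>))"
  using vs(1,2) assms(2)
proof (induction rule: tensor_space_induct)
  case zero
  then show ?case by (simp add: bilinear_on_def linear_on_def)
next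
  case (add x' y' v)
  then show ?case
    using bilinear_on_tens_apply[OF F add(1,2), of \<Phi>]
    by (simp add: bilinear_on_def linear_on_def algebra_simps)
qed

lemma tensor_lift2_add_left: "tensor_lift2 F (u + u') v = tensor_lift2 F u v + tensor_lift2 F u' v"
  by (rule ext) (simp add: tensor_lift2_def)

lemma tensor_lift2_add_right:
  assumes F: "quadrilinear_on s V t W F" and "u \<in> T" "v \<in> T" "v' \<in> T"
  shows "tensor_lift2 F u (v + v') = tensor_lift2 F u v + tensor_lift2 F u v'"
  using tensor_additive[OF assms(2) bilinear_on_tensor_apply[OF F assms(3)] bilinear_on_tensor_apply[OF F assms(4)]]
  by (intro ext) (simp add: tensor_lift2_def)

lemma tensor_lift2_scale_left: "tensor_lift2 F (fscale c u) v = fscale c (tensor_lift2 F u v)"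
  by (rule ext) (simp add: tensor_lift2_def fscale_def)

lemma tensor_lift2_scale_right:
  assumes F: "quadrilinear_on s V t W F" and "u \<in> T" "v \<in> T"
  shows "tensor_lift2 F u (fscale c v) = fscale c (tensor_lift2 F u v)"
  using tensor_homogeneous[OF assms(2) bilinear_on_tensor_apply[OF F assms(3)]]
  by (intro ext) (simp add: tensor_lift2_def fscale_def)

lemma tensor_lift2_zero_left: "tensor_lift2 F 0 v = 0"
  by (rule ext) (simp add: tensor_lift2_def)

lemma tensor_lift2_zero_right:
  "quadrilinear_on s V t W F \<Longrightarrow> u \<in> T \<Longrightarrow> tensor_lift2 F u 0 = 0"
  using tensor_lift2_add_right[of F u 0 0] T_zero by simp

lemma T_sum: "(\<And>i. i \<in> I \<Longrightarrow> u i \<in> T) \<Longrightarrow> sum u I \<in> T"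
  by (induction I rule: infinite_finite_induct) (simp_all add: T_zero T_add del: zero_fun_apply)

theorem tensor_lift2_sum:
  assumes F: "quadrilinear_on s V t W F" and "finite I" "finite J"
    and "\<And>i. i \<in> I \<Longrightarrow> x i \<in> V" "\<And>i. i \<in> I \<Longrightarrow> y i \<in> W"
    and "\<And>j. j \<in> J \<Longrightarrow> x' j \<in> V" "\<And>j. j \<in> J \<Longrightarrow> y' j \<in> W"
  shows "tensor_lift2 F (\<Sum>i\<in>I. tens s V t W (x i) (y i)) (\<Sum>j\<in>J. tens s V t W (x' j) (y' j))
    = (\<Sum>i\<in>I. \<Sum>j\<in>J. F (x i) (y i) (x' j) (y' j))"
proof -
  have 1: "tensor_lift2 F (tens s V t W p q) (\<Sum>j\<in>J. tens s V t W (x' j) (y' j))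
      = (\<Sum>j\<in>J. F p q (x' j) (y' j))" if pq: "p \<in> V" "q \<in> W" for p q
    using assms(3,6,7)
  proof (induction J rule: finite_induct)
    case empty
    show ?case
      unfolding sum.empty by (rule tensor_lift2_zero_right[OF F tens_in_tensor_space[OF pq]])
  next
    case (insert j J)
    have j: "x' j \<in> V" "y' j \<in> W" and J: "(\<Sum>j\<in>J. tens s V t W (x' j) (y' j)) \<in> T"
      using insert.prems by (auto intro!: T_sum tens_in_tensor_space)
    have IH: "tensor_lift2 F (tens s V t W p q) (\<Sum>j\<in>J. tens s V t W (x' j) (y' j))
      = (\<Sum>j\<in>J. F p q (x' j) (y' j))"
      using insert.prems by (intro insert.IH) auto
    show ?case
      unfolding sum.insert[OF insert.hyps] IH tensor_lift2_tens[OF F pq j]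
        tensor_lift2_add_right[OF F tens_in_tensor_space[OF pq] tens_in_tensor_space[OF j] J] ..
  qed
  show ?thesis
    using assms(2,4,5)
  proof (induction I rule: finite_induct)
    case empty
    show ?case unfolding sum.empty by (rule tensor_lift2_zero_left)
  next
    case (insert i I)
    have i: "x i \<in> V" "y i \<in> W"
      using insert.prems by auto
    have IH: "tensor_lift2 F (\<Sum>i\<in>I. tens s V t W (x i) (y i)) (\<Sum>j\<in>J. tens s V t W (x' j) (y' j))
      = (\<Sum>i\<in>I. \<Sum>j\<in>J. F (x i) (y i) (x' j) (y' j))"
      using insert.prems by (intro insert.IH) auto
    show ?case
      unfolding sum.insert[OF insert.hyps] tensor_lift2_add_left IH 1[OF i] ..
  qed
qed

lemma tensor_lift2_in_span:
  assumes F: "quadrilinear_on s V t W F" and "u \<in> T" "v \<in> T"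
    and Z: "fvs.subspace Z"
    and FZ: "\<And>x y x' y'. \<lbrakk>x \<in> V; y \<in> W; x' \<in> V; y' \<in> W\<rbrakk> \<Longrightarrow> F x y x' y' \<in> Z"
  shows "tensor_lift2 F u v \<in> Z"
proof -
  have 1: "tensor_lift2 F (tens s V t W p q) v \<in> Z" if "p \<in> V" "q \<in> W" for p q
    using vs(1,2) assms(3)
  proof (induction rule: tensor_space_induct)
    case zero
    then show ?case
      using tensor_lift2_zero_right[OF F] tens_in_tensor_space that fvs.subspace_0[OF Z] by metis
  next
    case (add x' y' v)
    have "tensor_lift2 F (tens s V t W p q) (tens s V t W x' y' + v)
        = F p q x' y' + tensor_lift2 F (tens s V t W p q) v"
      using add that
      by (simp add: tensor_lift2_add_right[OF F] tensor_lift2_tens[OF F] tens_in_tensor_space)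
    then show ?case
      using add that FZ fvs.subspace_add[OF Z] by metis
  qed
  show ?thesis
    using vs(1,2) assms(2)
  proof (induction rule: tensor_space_induct)
    case zero
    then show ?case
      using tensor_lift2_zero_left fvs.subspace_0[OF Z] by metis
  next
    case (add x y u)
    then show ?case
      using 1 tensor_lift2_add_left fvs.subspace_add[OF Z] by metis
  qed
qed

end


lemma (in graded_space) decomposition_exists:
  assumes "a \<in> total"
  shows "\<exists>c. (\<forall>j. c j \<in> G j) \<and> finite {j. c j \<noteq> 0} \<and> a = Sum_any c"
  using assms unfolding total_def
proof (induction rule: span_induct_alt)
  case base
  show ?case by (rule exI[of _ "\<lambda>_. 0"]) (simp add: subspace_0[OF subspace_G])
next
  case (step k w v)
  then obtain i c where w: "w \<in> G i" and c: "\<forall>j. c j \<in> G j" "finite {j. c j \<noteq> 0}" "v = Sum_any c"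
    by auto
  define d where "d = (\<lambda>j. if j = i then scale k w else 0)"
  have d: "\<forall>j. d j \<in> G j" "finite {j. d j \<noteq> 0}"
    using w subspace_G by (auto simp: d_def subspace_scale subspace_0)
  have "Sum_any d = scale k w"
    by (simp add: d_def)
  moreover have "Sum_any (\<lambda>j. d j + c j) = Sum_any d + Sum_any c"
    using d c by (intro Sum_any.distrib)
  moreover have "finite {j. d j + c j \<noteq> 0}"
    by (rule finite_subset[OF _ finite_UnI[OF d(2) c(2)]]) auto
  ultimately show ?case
    using d c subspace_add[OF subspace_G] by (intro exI[of _ "\<lambda>j. d j + c j"]) auto
qed

lemma (in graded_space) component_eqI:
  assumes "\<And>j. c j \<in> G j" "finite {j. c j \<noteq> 0}" "a = Sum_any c"
  shows "component i a = c i"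
proof -
  have "c' = c" if "(\<forall>j. c' j \<in> G j) \<and> finite {j. c' j \<noteq> 0} \<and> a = Sum_any c'" for c'
  proof
    fix j
    have fin: "finite {j. - c j \<noteq> 0}" using assms(2) by simp
    have "Sum_any (\<lambda>j. c' j + - c j) = Sum_any c' + Sum_any (\<lambda>j. - c j)"
      using that fin by (intro Sum_any.distrib) auto
    also have "Sum_any (\<lambda>j. - c j) = - Sum_any c"
      by (simp add: Sum_any.expand_set sum_negf)
    finally have "Sum_any (\<lambda>j. c' j + - c j) = 0"
      using that assms(3) by simp
    moreover have "finite {j. c' j + - c j \<noteq> 0}"
      by (rule finite_subset[of _ "{j. c' j \<noteq> 0} \<union> {j. c j \<noteq> 0}"]) (use that assms(2) in auto)
    moreover have "c' j + - c j \<in> G j" for j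
      using that assms(1) subspace_diff[OF subspace_G, of "c' j" j "c j"] by simp
    ultimately have "c' j + - c j = 0"
      using direct_G[of "\<lambda>j. c' j + - c j"] by blast
    then show "c' j = c j" by simp
  qed
  then have "(THE c. (\<forall>j. c j \<in> G j) \<and> finite {j. c j \<noteq> 0} \<and> a = Sum_any c) = c"
    using assms by (intro the_equality) auto
  then show ?thesis by (simp add: component_def)
qed

lemma (in graded_space) component_homogeneous:
  assumes "a \<in> G j"
  shows "component i a = (if i = j then a else 0)"
  using assms by (intro component_eqI) (auto simp: subspace_0[OF subspace_G])

lemma (in graded_space) component_props:
  assumes "a \<in> total"
  shows "component i a \<in> G i" "finite {i. component i a \<noteq> 0}"
    "a = Sum_any (\<lambda>i. component i a)"
proof -
  obtain c where c: "\<forall>j. c j \<in> G j" "finite {j. c j \<noteq> 0}" "a = Sum_any c"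
    using decomposition_exists[OF assms] by blast
  then have "(\<lambda>i. component i a) = c"
    using component_eqI by blast
  then have eq: "\<And>i. component i a = c i" by meson
  show "component i a \<in> G i" "finite {i. component i a \<noteq> 0}" "a = Sum_any (\<lambda>i. component i a)"
    unfolding eq using c by auto
qed

lemma (in graded_space) component_linear: "linear_on scale total scale (component i)"
proof -
  have "component i (x + y) = component i x + component i y" if "x \<in> total" "y \<in> total" for x y
  proof (rule component_eqI)
    note p = component_props[OF that(1)] component_props[OF that(2)]
    show "component j x + component j y \<in> G j" for j
      using p subspace_add[OF subspace_G] by blast
    show "finite {j. component j x + component j y \<noteq> 0}"
      by (rule finite_subset[OF _ finite_UnI[OF p(2) p(5)]]) auto
    show "x + y = Sum_any (\<lambda>j. component j x + component j y)"
      using p by (simp add: Sum_any.distrib)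
  qed
  moreover have "component i (scale k x) = scale k (component i x)" if "x \<in> total" for x k
  proof (rule component_eqI)
    note p = component_props[OF that]
    show "scale k (component j x) \<in> G j" for j
      using p subspace_scale[OF subspace_G] by blast
    show fin: "finite {j. scale k (component j x) \<noteq> 0}"
      by (rule finite_subset[OF _ p(2)]) auto
    have "scale k x = scale k (sum (\<lambda>j. component j x) {j. component j x \<noteq> 0})"
      using p(3) by (simp add: Sum_any.expand_set)
    also have "\<dots> = sum (\<lambda>j. scale k (component j x)) {j. component j x \<noteq> 0}"
      by (rule scale_sum_right)
    also have "\<dots> = Sum_any (\<lambda>j. scale k (component j x))"
      by (rule Sum_any.expand_superset[symmetric, OF p(2)]) auto
    finally show "scale k x = Sum_any (\<lambda>j. scale k (component j x))" .
  qed
  ultimately show ?thesis by (simp add: linear_on_def)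
qed

lemma (in graded_space) G_subset_total: "G i \<subseteq> total"
  unfolding total_def by (auto intro: span_base)

locale induced_setting =
  p: poisson_algebra sP mul br + b: graded_perm_algebra sB G circB
  for sP :: "'k::field \<Rightarrow> 'p::ab_group_add \<Rightarrow> 'p" and mul br
    and sB :: "'k \<Rightarrow> 'b::ab_group_add \<Rightarrow> 'b" and G circB +
  assumes P_fin_dim: "\<exists>F. finite F \<and> p.span F = UNIV"
begin

sublocale subspace_pair sP UNIV sB UNIV
  by unfold_locales auto

abbreviation tn where "tn \<equiv> tens sP UNIV sB UNIV"
abbreviation A where "A \<equiv> induced_grading sP sB G"
abbreviation circ where "circ \<equiv> induced_product sP sB mul circB"
abbreviation ast where "ast \<equiv> induced_product sP sB br circB"

lemma tens_bilinear: "bilinear_on sP UNIV sB UNIV fscale tn"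
  by (rule bilinear_on_tens) (use vs in auto)

lemma tens_simps:
  "tn (p + p') b = tn p b + tn p' b" "tn p (b + b') = tn p b + tn p b'"
  "tn (sP c p) b = fscale c (tn p b)" "tn p (sB c b) = fscale c (tn p b)"
  using tens_bilinear by (simp_all add: bilinear_on_def linear_on_def)

lemma tens_minus: "tn (- p) b = - tn p b"
  using tens_simps(3)[of "-1" p b] by (simp add: fun_eq_iff fscale_def)

lemma product_quadrilinear:
  assumes "bilinear_on sP UNIV sP UNIV sP m"
  shows "quadrilinear_on sP UNIV sB UNIV (\<lambda>p b p' b'. tn (m p p') (circB b b'))"
  using assms b.circ_bilinear
  by (simp add: quadrilinear_on_def bilinear_on_def linear_on_def tens_simps)

lemma induced_product_tens:
  assumes "bilinear_on sP UNIV sP UNIV sP m"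
  shows "induced_product sP sB m circB (tn p b) (tn p' b') = tn (m p p') (circB b b')"
  unfolding induced_product_def
  by (rule tensor_lift2_tens[OF product_quadrilinear[OF assms]]) auto

lemma induced_product_bilinear:
  assumes "bilinear_on sP UNIV sP UNIV sP m"
  shows "bilinear_on fscale T fscale T fscale (induced_product sP sB m circB)"
  unfolding bilinear_on_def linear_on_def induced_product_def
  by (intro conjI ballI allI tensor_lift2_add_left tensor_lift2_scale_left
      tensor_lift2_add_right[OF product_quadrilinear[OF assms]]
      tensor_lift2_scale_right[OF product_quadrilinear[OF assms]])

lemma induced_product_simps:
  assumes "bilinear_on sP UNIV sP UNIV sP m" "u \<in> T" "u' \<in> T" "v \<in> T"
  shows "induced_product sP sB m circB (u + u') v
      = induced_product sP sB m circB u v + induced_product sP sB m circB u' v"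
    "induced_product sP sB m circB v (u + u')
      = induced_product sP sB m circB v u + induced_product sP sB m circB v u'"
    "induced_product sP sB m circB (fscale c u) v = fscale c (induced_product sP sB m circB u v)"
    "induced_product sP sB m circB v (fscale c u) = fscale c (induced_product sP sB m circB v u)"
  using induced_product_bilinear[OF assms(1)] assms(2-4)
  unfolding bilinear_on_def linear_on_def by blast+

lemma induced_product_closed:
  assumes "bilinear_on sP UNIV sP UNIV sP m" "u \<in> T" "v \<in> T"
  shows "induced_product sP sB m circB u v \<in> T"
  unfolding induced_product_def
  using product_quadrilinear[OF assms(1)] assms(2,3)
  by (rule tensor_lift2_in_span)
    (auto simp: tensor_space_def intro: fvs.span_base)

lemma A_subset_T: "A i \<subseteq> T"
  unfolding induced_grading_def tensor_space_def by (rule fvs.span_mono) auto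

lemma T_eq: "T = fvs.span (\<Union>i. A i)"
proof
  show "fvs.span (\<Union>i. A i) \<subseteq> T"
    unfolding tensor_space_def
    by (rule fvs.span_minimal) (use A_subset_T in \<open>auto simp: tensor_space_def\<close>)
  have "tn p b \<in> fvs.span (\<Union>i. A i)" for p b
  proof -
    have "b \<in> b.span (\<Union>i. G i)"
      using b.total_UNIV by (simp add: b.total_def)
    then show ?thesis
    proof (induction rule: b.span_induct_alt)
      case base
      have "tn p 0 = 0" using tens_simps(4)[of p 0 0] by (simp add: fun_eq_iff fscale_def)
      then show ?case using fvs.span_zero by metis
    next
      case (step c x y)
      then have "tn p x \<in> (\<Union>i. A i)"
        unfolding induced_grading_def by (auto intro!: fvs.span_base)
      then show ?case
        using step by (metis tens_simps(2,4) fvs.span_add fvs.span_scale fvs.span_base)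
    qed
  qed
  then show "T \<subseteq> fvs.span (\<Union>i. A i)"
    unfolding tensor_space_def by (intro fvs.span_minimal) auto
qed

lemma component_form:
  assumes "bilinear_on sP UNIV sB UNIV (*) \<phi>"
  shows "bilinear_on sP UNIV sB UNIV (*) (\<lambda>p b. \<phi> p (b.component i b))"
  using assms b.component_linear[of i]
  by (simp add: bilinear_on_def linear_on_def b.total_UNIV)

lemma A_component:
  assumes "u \<in> A j" and \<phi>: "bilinear_on sP UNIV sB UNIV (*) \<phi>"
  shows "u (\<lambda>p b. \<phi> p (b.component i b)) = (if i = j then u \<phi> else 0)"
  using assms(1) unfolding induced_grading_def
proof (induction rule: fvs.span_induct_alt)
  case base
  then show ?case by simp
next
  case (step c w v)
  then obtain p b where w: "w = tn p b" "b \<in> G j" by auto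
  have "\<phi> p 0 = 0"
    using \<phi> by (auto simp: bilinear_on_def linear_on_def) (metis b.scale_zero_left mult_zero_left)
  then show ?case
    using step w by (simp add: fscale_def tens_apply \<phi> component_form b.component_homogeneous)
qed

lemma T_non_bilinear:
  assumes "u \<in> T" "\<not> bilinear_on sP UNIV sB UNIV (*) \<phi>"
  shows "u \<phi> = 0"
  using vs(1,2) assms(1)
  by (induction rule: tensor_space_induct) (simp_all add: tens_def assms(2))

lemma graded_space_A: "graded_space fscale A"
proof unfold_locales
  show "fvs.subspace (A i)" for i
    unfolding induced_grading_def by (rule fvs.subspace_span)
  show "\<exists>F. finite F \<and> fvs.span F = A i" for i
  proof -
    obtain F where F: "finite F" "p.span F = UNIV" using P_fin_dim by blast
    obtain H where H: "finite H" "b.span H = G i" using b.finite_dim_G by blast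
    let ?K = "(\<lambda>(p, b). tn p b) ` (F \<times> H)"
    have 1: "tn p b \<in> fvs.span ?K" if "b \<in> H" for p b
    proof -
      have "p \<in> p.span F" using F by simp
      then show ?thesis
      proof (induction rule: p.span_induct_alt)
        case base
        have "tn 0 b = 0" using tens_simps(3)[of 0 0 b] by (simp add: fun_eq_iff fscale_def)
        then show ?case using fvs.span_zero by metis
      next
        case (step c x y)
        have "tn x b \<in> ?K" using step that by auto
        then show ?case
          using step(2) by (simp only: tens_simps fvs.span_add fvs.span_scale fvs.span_base)
      qed
    qed
    have 2: "tn p b \<in> fvs.span ?K" if "b \<in> G i" for p b
    proof -
      have "b \<in> b.span H" using H that by simp
      then show ?thesis
      proof (induction rule: b.span_induct_alt)
        case base
        have "tn p 0 = 0" using tens_simps(4)[of p 0 0] by (simp add: fun_eq_iff fscale_def)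
        then show ?case using fvs.span_zero by metis
      next
        case (step c x y)
        then show ?case
          using 1[of x p] by (simp only: tens_simps fvs.span_add fvs.span_scale)
      qed
    qed
    have "fvs.span ?K \<subseteq> A i"
      unfolding induced_grading_def
      using H b.span_superset[of H] by (intro fvs.span_mono) auto
    moreover have "A i \<subseteq> fvs.span ?K"
      unfolding induced_grading_def
      by (rule fvs.span_minimal) (use 2 in auto)
    ultimately show ?thesis using F(1) H(1) by (intro exI[of _ ?K]) auto
  qed
  fix c :: "int \<Rightarrow> ('k, 'p, 'b) tensor" and i
  assume fin: "finite {i. c i \<noteq> 0}" and mem: "\<And>i. c i \<in> A i" and zero: "Sum_any c = 0"
  have "c i \<phi> = 0" for \<phi>
  proof (cases "bilinear_on sP UNIV sB UNIV (*) \<phi>")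
    case True
    let ?\<psi> = "\<lambda>p b. \<phi> p (b.component i b)"
    have app: "(\<Sum>j\<in>J. c j) \<psi> = (\<Sum>j\<in>J. c j \<psi>)" if "finite J" for J and \<psi>
      using that by (induction J) auto
    have "0 = Sum_any c ?\<psi>" using zero by simp
    also have "\<dots> = (\<Sum>j\<in>{j. c j \<noteq> 0}. c j ?\<psi>)"
      by (simp add: Sum_any.expand_set app[OF fin])
    also have "\<dots> = (\<Sum>j\<in>{j. c j \<noteq> 0}. if i = j then c j \<phi> else 0)"
      by (intro sum.cong refl A_component mem True)
    also have "\<dots> = c i \<phi>"
      using fin by (auto simp: sum.delta)
    finally show ?thesis by simp
  next
    case False
    then show ?thesis using T_non_bilinear mem A_subset_T by blast
  qed
  then show "c i = 0" by (simp add: fun_eq_iff)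
qed

sublocale gr: graded_space fscale A
  by (rule graded_space_A)

lemma total_eq_T: "gr.total = T"
  unfolding gr.total_def T_eq ..

lemma T_scale: "u \<in> T \<Longrightarrow> fscale c u \<in> T"
  unfolding tensor_space_def by (rule fvs.span_scale)

lemma tn_in_T: "tn p b \<in> T"
  by (simp add: tens_in_tensor_space)

lemma A_add: "u \<in> A i \<Longrightarrow> v \<in> A i \<Longrightarrow> u + v \<in> A i"
  unfolding induced_grading_def by (rule fvs.span_add)

lemma A_scale: "u \<in> A i \<Longrightarrow> fscale c u \<in> A i"
  unfolding induced_grading_def by (rule fvs.span_scale)

lemma A_zero: "0 \<in> A i"
  unfolding induced_grading_def by (rule fvs.span_zero)

lemma induced_product_graded:
  assumes m: "bilinear_on sP UNIV sP UNIV sP m" and "u \<in> A i" "v \<in> A j"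
  shows "induced_product sP sB m circB u v \<in> A (i + j)"
proof -
  note zl = tensor_lift2_zero_left and zr = tensor_lift2_zero_right[OF product_quadrilinear[OF m]]
  have 1: "induced_product sP sB m circB (tn p b) v \<in> A (i + j)" if "b \<in> G i" for p b
  proof -
    have "induced_product sP sB m circB (tn p b) v \<in> A (i + j) \<and> v \<in> T"
      using assms(3) unfolding induced_grading_def[of _ _ _ j]
    proof (induction rule: fvs.span_induct_alt)
      case base
      show ?case using zr[OF tn_in_T] A_zero T_zero
        unfolding induced_product_def by metis
    next
      case (step c w v)
      then obtain p' b' where w: "w = tn p' b'" "b' \<in> G j" by auto
      have "tn (m p p') (circB b b') \<in> A (i + j)"
        unfolding induced_grading_def using b.circ_graded[OF that w(2)]
        by (intro fvs.span_base) auto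
      then have 1: "fscale c (induced_product sP sB m circB (tn p b) w) \<in> A (i + j)"
        unfolding w induced_product_tens[OF m] by (rule A_scale)
      have T: "fscale c w \<in> T" "w \<in> T" "v \<in> T"
        unfolding w using step(2) by (auto intro: T_scale tn_in_T)
      have "induced_product sP sB m circB (tn p b) (fscale c w + v) \<in> A (i + j)"
        unfolding induced_product_simps(2)[OF m T(1,3) tn_in_T]
          induced_product_simps(4)[OF m T(2,2) tn_in_T]
        using 1 step(2) by (blast intro: A_add)
      then show ?case using T T_add by blast
    qed
    then show ?thesis ..
  qed
  have v: "v \<in> T" using assms(3) A_subset_T by blast
  have "induced_product sP sB m circB u v \<in> A (i + j) \<and> u \<in> T"
    using assms(2) unfolding induced_grading_def[of _ _ _ i]
  proof (induction rule: fvs.span_induct_alt)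
    case base
    show ?case using zl A_zero T_zero unfolding induced_product_def by metis
  next
    case (step c w u)
    then obtain p b where w: "w = tn p b" "b \<in> G i" by auto
    have T: "fscale c w \<in> T" "w \<in> T" "u \<in> T"
      unfolding w using step(2) by (auto intro: T_scale tn_in_T)
    have "induced_product sP sB m circB (fscale c w + u) v \<in> A (i + j)"
      unfolding induced_product_simps(1)[OF m T(1,3) v] induced_product_simps(3)[OF m T(2,2) v]
      using 1[OF w(2)] step(2) w(1) by (blast intro: A_add A_scale)
    then show ?case using T T_add by blast
  qed
  then show ?thesis ..
qed

definition triadditive where
  "triadditive L \<longleftrightarrow> (\<forall>u\<in>T. \<forall>v\<in>T. \<forall>w\<in>T. \<forall>u'\<in>T.
    L (u + u') v w = L u v w + L u' v w \<and> L v (u + u') w = L v u w + L v u' w \<and>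
    L v w (u + u') = L v w u + L v w u')"

lemma triadditive_simps:
  assumes "triadditive L" "u \<in> T" "u' \<in> T" "v \<in> T" "w \<in> T"
  shows "L (u + u') v w = L u v w + L u' v w" "L v (u + u') w = L v u w + L v u' w"
    "L v w (u + u') = L v w u + L v w u'"
  using assms unfolding triadditive_def by blast+

lemma triadditive_swap: "triadditive L \<Longrightarrow> triadditive (\<lambda>u v w. L v u w)"
  unfolding triadditive_def by blast

lemma triadditive_add:
  fixes L L' :: "_ \<Rightarrow> _ \<Rightarrow> _ \<Rightarrow> ('k, 'p, 'b) tensor"
  assumes "triadditive L" "triadditive L'"
  shows "triadditive (\<lambda>u v w. L u v w + L' u v w)"
proof -
  have shuffle: "x + y + (x' + y') = x + x' + (y + y')" for x y x' y' :: "('k, 'p, 'b) tensor"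
    by (simp only: ac_simps)
  show ?thesis
    unfolding triadditive_def
    by (intro ballI conjI; simp only: triadditive_simps[OF assms(1)] triadditive_simps[OF assms(2)];
        rule shuffle)
qed

lemma triadditive_minus:
  fixes L :: "_ \<Rightarrow> _ \<Rightarrow> _ \<Rightarrow> ('k, 'p, 'b) tensor"
  assumes "triadditive L"
  shows "triadditive (\<lambda>u v w. - L u v w)"
  unfolding triadditive_def
  by (intro ballI conjI; simp only: triadditive_simps[OF assms] minus_add_distrib)

lemma triadditive_zero:
  fixes L :: "_ \<Rightarrow> _ \<Rightarrow> _ \<Rightarrow> ('k, 'p, 'b) tensor"
  assumes "triadditive L" "v \<in> T" "w \<in> T"
  shows "L 0 v w = 0" "L v 0 w = 0" "L v w 0 = 0"
  using triadditive_simps[OF assms(1) T_zero T_zero assms(2,3)] by simp_all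

lemma triadditive_eqI:
  fixes L L' :: "('k, 'p, 'b) tensor \<Rightarrow> ('k, 'p, 'b) tensor \<Rightarrow> ('k, 'p, 'b) tensor \<Rightarrow> ('k, 'p, 'b) tensor"
  assumes L: "triadditive L" and L': "triadditive L'"
    and eq: "\<And>p b p' b' p'' b''. L (tn p b) (tn p' b') (tn p'' b'') = L' (tn p b) (tn p' b') (tn p'' b'')"
    and "u \<in> T" "v \<in> T" "w \<in> T"
  shows "L u v w = L' u v w"
proof -
  note s = triadditive_simps[OF L] triadditive_simps[OF L'] triadditive_zero[OF L] triadditive_zero[OF L']
  have 1: "L (tn p b) (tn p' b') w = L' (tn p b) (tn p' b') w" for p b p' b'
    using vs(1,2) assms(6)
    by (induction rule: tensor_space_induct) (simp_all only: s tn_in_T eq)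
  have 2: "L (tn p b) v w = L' (tn p b) v w" for p b
    using vs(1,2) assms(5)
    by (induction rule: tensor_space_induct) (simp_all only: s tn_in_T 1 assms(6))
  show ?thesis
    using vs(1,2) assms(4)
    by (induction rule: tensor_space_induct) (simp_all only: s tn_in_T 2 assms(5,6))
qed

lemmas circ_tens = induced_product_tens[OF p.mul_bilinear]
lemmas ast_tens = induced_product_tens[OF p.br_bilinear]

lemma product_simps:
  "u \<in> T \<Longrightarrow> u' \<in> T \<Longrightarrow> v \<in> T \<Longrightarrow> circ (u + u') v = circ u v + circ u' v"
  "u \<in> T \<Longrightarrow> u' \<in> T \<Longrightarrow> v \<in> T \<Longrightarrow> circ v (u + u') = circ v u + circ v u'"
  "u \<in> T \<Longrightarrow> u' \<in> T \<Longrightarrow> v \<in> T \<Longrightarrow> ast (u + u') v = ast u v + ast u' v"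
  "u \<in> T \<Longrightarrow> u' \<in> T \<Longrightarrow> v \<in> T \<Longrightarrow> ast v (u + u') = ast v u + ast v u'"
  "u \<in> T \<Longrightarrow> v \<in> T \<Longrightarrow> circ u v \<in> T" "u \<in> T \<Longrightarrow> v \<in> T \<Longrightarrow> ast u v \<in> T"
  using induced_product_bilinear[OF p.mul_bilinear] induced_product_bilinear[OF p.br_bilinear]
    induced_product_closed[OF p.mul_bilinear] induced_product_closed[OF p.br_bilinear]
  by (simp_all add: bilinear_on_def linear_on_def)

lemma triadditive_products:
  "triadditive (\<lambda>u v w. circ u (circ v w))" "triadditive (\<lambda>u v w. circ (circ u v) w)"
  "triadditive (\<lambda>u v w. ast u (ast v w))" "triadditive (\<lambda>u v w. ast (ast u v) w)"
  "triadditive (\<lambda>u v w. circ u (ast v w))" "triadditive (\<lambda>u v w. circ (ast u v) w)"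
  "triadditive (\<lambda>u v w. ast u (circ v w))" "triadditive (\<lambda>u v w. ast (circ u v) w)"
  unfolding triadditive_def by (intro ballI conjI; simp only: product_simps)+

lemma br_skew: "br p q = - br q p"
proof -
  have "br (p + q) (p + q) = br p p + br q p + (br p q + br q q)"
    using p.br_bilinear by (simp add: bilinear_on_def linear_on_def)
  then show ?thesis by (simp add: p.br_self eq_neg_iff_add_eq_0 add.commute)
qed

lemma br_minus: "br p (- q) = - br p q"
proof -
  have "br p (sP (-1) q) = sP (-1) (br p q)"
    using p.br_bilinear unfolding bilinear_on_def linear_on_def by blast
  then show ?thesis by simp
qed

lemma mul_minus: "mul (- p) q = - mul p q"
proof -
  have "mul (sP (-1) p) q = sP (-1) (mul p q)"
    using p.mul_bilinear unfolding bilinear_on_def linear_on_def by blast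
  then show ?thesis by simp
qed

lemma tens_diff: "tn (p - q) b = tn p b - tn q b"
  using tens_simps(1)[of p "- q" b] by (simp add: tens_minus del: plus_fun_apply)

theorem induced_dpp_algebra: "graded_dpp_algebra fscale A circ ast"
proof (intro graded_dpp_algebra.intro graded_space_A graded_dpp_algebra_axioms.intro)
  show "bilinear_on fscale gr.total fscale gr.total fscale circ"
    "bilinear_on fscale gr.total fscale gr.total fscale ast"
    unfolding total_eq_T
    by (intro induced_product_bilinear p.mul_bilinear p.br_bilinear)+
  show "circ u v \<in> A (i + j)" "ast u v \<in> A (i + j)" if "u \<in> A i" "v \<in> A j" for u v i j
    using that by (intro induced_product_graded p.mul_bilinear p.br_bilinear; simp)+
  fix a b c assume "a \<in> gr.total" "b \<in> gr.total" "c \<in> gr.total"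
  then have abc: "a \<in> T" "b \<in> T" "c \<in> T" by (simp_all only: total_eq_T)
  note eqI = triadditive_eqI[OF _ _ _ abc]
  have pure0: "tn (mul p (mul q r)) (circB x (circB y z)) = tn (mul (mul p q) r) (circB (circB x y) z)"
    for p q r x y z by (simp only: p.mul_assoc b.circ_assoc)
  have pure1: "tn (mul (mul p q) r) (circB (circB x y) z) = tn (mul (mul q p) r) (circB (circB y x) z)"
    for p q r x y z using p.mul_commute[of p q] b.circ_perm[of x y z] by simp
  have B: "circB y (circB x z) = circB x (circB y z)" "circB (circB x y) z = circB x (circB y z)" for x y z
    by (metis b.circ_assoc b.circ_perm)+
  have J: "br p (br q r) = br (br p q) r + br q (br p r)" for p q r
    using p.br_jacobi[of p q r] br_skew[of r "br p q"] br_skew[of r p] br_minus[of q "br p r"]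
    by (simp add: algebra_simps)
  have M: "mul (br p q) r = br p (mul q r) - mul q (br p r)" for p q r
    by (simp add: p.br_mul)
  have N: "br (mul p q) r = mul p (br q r) + mul q (br p r)" for p q r
    using p.br_mul[of r p q] br_skew[of r] mul_minus p.mul_commute
    by (simp add: br_skew[of "mul p q" r] p.br_mul br_skew[of r p] br_skew[of r q])
  have pure2: "tn (br p (br q r)) (circB x (circB y z)) = tn (br (br p q) r) (circB (circB x y) z)
      + tn (br q (br p r)) (circB y (circB x z))" for p q r x y z
    unfolding B[of y x z] B(2)[of x y z] tens_simps(1)[symmetric] J[symmetric] ..
  have pure3: "tn (br (mul p q) r) (circB (circB x y) z) = tn (mul p (br q r)) (circB x (circB y z))
      + tn (mul q (br p r)) (circB y (circB x z))" for p q r x y z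
    unfolding B[of y x z] B(2)[of x y z] tens_simps(1)[symmetric] N ..
  have pure4: "tn (mul (br p q) r) (circB (circB x y) z) = tn (br p (mul q r)) (circB x (circB y z))
      - tn (mul q (br p r)) (circB y (circB x z))" for p q r x y z
    unfolding B[of y x z] B(2)[of x y z] tens_diff[symmetric] M[symmetric] ..
  have pure5: "tn (mul (br p q) r) (circB (circB x y) z) = - tn (mul (br q p) r) (circB (circB y x) z)"
    for p q r x y z
    unfolding b.circ_perm[of x y z] tens_minus[symmetric] mul_minus[symmetric] br_skew[symmetric] ..
  note tri = triadditive_products
  have swap: "triadditive (\<lambda>u v w. circ (circ v u) w)" "triadditive (\<lambda>u v w. ast v (ast u w))"
    "triadditive (\<lambda>u v w. circ v (ast u w))" "triadditive (\<lambda>u v w. circ (ast v u) w)"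
    using triadditive_swap[OF tri(2)] triadditive_swap[OF tri(3)] triadditive_swap[OF tri(5)]
      triadditive_swap[OF tri(6)] by - assumption+
  from eqI[OF tri(1,2)] show "circ a (circ b c) = circ (circ a b) c"
    unfolding circ_tens using pure0 by blast
  from eqI[OF tri(2) swap(1)] show "circ (circ a b) c = circ (circ b a) c"
    unfolding circ_tens using pure1 by blast
  from eqI[OF tri(3) triadditive_add[OF tri(4) swap(2)]]
  show "ast a (ast b c) = ast (ast a b) c + ast b (ast a c)"
    unfolding ast_tens using pure2 by blast
  from eqI[OF tri(8) triadditive_add[OF tri(5) swap(3)]]
  show "ast (circ a b) c = circ a (ast b c) + circ b (ast a c)"
    unfolding circ_tens ast_tens using pure3 by blast
  from eqI[OF tri(6) triadditive_add[OF tri(7) triadditive_minus[OF swap(3)]]]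
  show "circ (ast a b) c = ast a (circ b c) - circ b (ast a c)"
    unfolding circ_tens ast_tens diff_conv_add_uminus
    using pure4[unfolded diff_conv_add_uminus] by blast
  from eqI[OF tri(6) triadditive_minus[OF swap(4)]]
  show "circ (ast a b) c = - circ (ast b a) c"
    unfolding circ_tens ast_tens using pure5 by blast
qed

end

lemma (in quadratic_graded_perm_algebra) finite_degree_terms:
  assumes "dual_homogeneous_bases \<Omega> e f"
  shows "finite {j\<in>\<Omega>. e j \<in> G k \<and> f j \<in> G l}"
proof -
  let ?J = "{j\<in>\<Omega>. e j \<in> G k \<and> f j \<in> G l}"
  have e: "inj_on e \<Omega>" "independent (e ` \<Omega>)"
    using assms unfolding dual_homogeneous_bases_def homogeneous_basis_def by auto
  obtain F where F: "finite F" "span F = G k" using finite_dim_G by blast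
  have "independent (e ` ?J)"
    by (rule independent_mono[OF e(2)]) auto
  moreover have "e ` ?J \<subseteq> span F" using F by auto
  ultimately have "finite (e ` ?J)" using independent_span_bound[OF F(1)] by blast
  then show ?thesis
    using inj_on_subset[OF e(1)] by (rule finite_imageD) auto
qed


end

theory Submission
  imports Defs
begin

text \<open>
  The element \<open>\<Sum> e\<^sub>j \<otimes> f\<^sub>j\<close> is dual to the form \<open>\<omega>\<close>. Expanding in the dual bases and using invariance
  of \<open>\<omega>\<close>, each of the \<open>B\<close>-parts \<open>\<Sum> e\<^sub>a \<otimes> f\<^sub>a e\<^sub>b \<otimes> f\<^sub>b\<close>, \<open>\<Sum> e\<^sub>a \<otimes> e\<^sub>b \<otimes> f\<^sub>a f\<^sub>b\<close>, \<dots> of the terms of the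
  DPYBE becomes a combination of \<open>M = \<Sum> e\<^sub>a e\<^sub>b \<otimes> f\<^sub>a \<otimes> f\<^sub>b\<close> and \<open>M' = \<Sum> e\<^sub>a e\<^sub>b \<otimes> f\<^sub>b \<otimes> f\<^sub>a\<close>. The two
  equations then take the form \<open>A\<^sub>r \<otimes> (M - M') = 0\<close> and \<open>C\<^sub>r \<otimes> M = 0\<close>. Since \<open>\<omega>\<close> is skew-symmetric,
  so is \<open>\<Sum> e\<^sub>j \<otimes> f\<^sub>j\<close>; this gives (i), and in (ii) it identifies the difference of the induced
  element and its flip with the element induced by \<open>r + \<tau>(r)\<close>. Tensors are compared by evaluating
  them at multilinear forms; after projection to a fixed degree only finitely many basis indices
  contribute.
\<close>

section \<open>Finite sums and dual families\<close>

text \<open>The fibres of \<open>D\<close> partition \<open>W\<close>; as \<open>\<tau>\<close>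
  vanishes off \<open>N\<close>, each fibre sum can be cut down to \<open>N\<close>. In the
  applications \<open>D\<close> is the degree of a term, so a sum over infinitely many degrees
  becomes a finite sum over basis indices.\<close>

lemma Sum_any_fibres:
  fixes t :: "'d \<Rightarrow> 'c::comm_monoid_add"
  assumes N: "finite N" "N \<subseteq> W" "\<And>w. w \<in> W - N \<Longrightarrow> \<tau> w = 0"
    and W: "\<And>d. finite {w\<in>W. D w = d}" and t: "\<And>d. t d = (\<Sum>w | w \<in> W \<and> D w = d. \<tau> w)"
  shows "finite {d. t d \<noteq> 0}" "Sum_any t = sum \<tau> N"
proof -
  have t': "t d = (\<Sum>w | w \<in> N \<and> D w = d. \<tau> w)" for d
    unfolding t by (rule sum.mono_neutral_right[OF W]) (use N in auto)
  have sub: "{d. t d \<noteq> 0} \<subseteq> D ` N"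
  proof
    fix d assume "d \<in> {d. t d \<noteq> 0}"
    then have "{w \<in> N. D w = d} \<noteq> {}" unfolding t' by force
    then show "d \<in> D ` N" by auto
  qed
  then show "finite {d. t d \<noteq> 0}" using N(1) finite_surj by blast
  have "Sum_any t = sum t (D ` N)"
    using N(1) sub by (intro Sum_any.expand_superset) auto
  also have "\<dots> = sum \<tau> N"
    unfolding t' using N(1) by (rule sum.image_gen[symmetric])
  finally show "Sum_any t = sum \<tau> N" .
qed

lemma linear_on_scaled_sum:
  assumes "vector_space s" and h: "linear_on s UNIV (*) h"
  shows "h (\<Sum>c\<in>C. s (k c) (v c)) = (\<Sum>c\<in>C. k c * h (v c))"
proof -
  interpret vector_space s by fact
  have h': "h (u + v) = h u + h v" "h (s c u) = c * h u" for u v c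
    using h by (simp_all add: linear_on_def)
  have "h 0 = 0" using h'(2)[of 0 0] by simp
  then show ?thesis by (induction C rule: infinite_finite_induct) (simp_all add: h')
qed

text \<open>Applying \<open>g d\<close> to a finite combination of the \<open>e c\<close> reads off
  its coefficient at \<open>d\<close>. The condition on \<open>N\<close> concerns the product
  \<open>g c u * h (e c)\<close>, so \<open>N\<close> can come from the support of \<open>h\<close>
  as well as from the coefficients of \<open>u\<close>.\<close>

lemma (in vector_space) dual_family_expansion:
  assumes span: "span (e ` \<Omega>) = UNIV"
    and g: "\<And>c. linear_on scale UNIV (*) (g c)"
    and dual: "\<And>c d. c \<in> \<Omega> \<Longrightarrow> d \<in> \<Omega> \<Longrightarrow> g c (e d) = (if c = d then 1 else 0)"
    and h: "linear_on scale UNIV (*) h"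
    and N: "finite N" "N \<subseteq> \<Omega>" "\<And>c. c \<in> \<Omega> - N \<Longrightarrow> g c u * h (e c) = 0"
  shows "h u = (\<Sum>c\<in>N. g c u * h (e c))"
proof -
  note expand = linear_on_scaled_sum[OF vector_space_axioms]
  have inj: "inj_on e \<Omega>"
  proof (rule inj_onI)
    fix c d assume "c \<in> \<Omega>" "d \<in> \<Omega>" "e c = e d"
    then show "c = d" using dual[of c c] dual[of c d] by (auto split: if_splits)
  qed
  have "u \<in> span (e ` \<Omega>)" using span by simp
  then obtain S k where S: "finite S" "S \<subseteq> e ` \<Omega>" "u = (\<Sum>a\<in>S. scale (k a) a)"
    unfolding span_explicit by blast
  obtain C where C: "C \<subseteq> \<Omega>" "finite C" "S = e ` C"
    using finite_subset_image[OF S(1,2)] by blast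
  have u: "u = (\<Sum>c\<in>C. scale (k (e c)) (e c))"
    unfolding S(3) C(3) using sum.reindex[OF inj_on_subset[OF inj C(1)]] by simp
  have gu: "g d u = (if d \<in> C then k (e d) else 0)" if "d \<in> \<Omega>" for d
  proof -
    have "g d u = (\<Sum>c\<in>C. k (e c) * g d (e c))" unfolding u by (rule expand[OF g])
    also have "\<dots> = (\<Sum>c\<in>C. if d = c then k (e c) else 0)"
      using dual[OF that] C(1) by (intro sum.cong) auto
    finally show ?thesis using C(2) by simp
  qed
  have "h u = (\<Sum>c\<in>C. k (e c) * h (e c))" unfolding u by (rule expand[OF h])
  also have "\<dots> = (\<Sum>c\<in>C. g c u * h (e c))"
    using gu C(1) by (intro sum.cong) auto
  \<comment> \<open>Indices in \<open>N - C\<close> have coefficient 0 in \<open>u\<close>; those in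
    \<open>C - N\<close> drop out by the assumption on \<open>N\<close>.\<close>
  also have "\<dots> = (\<Sum>c\<in>C \<union> N. g c u * h (e c))"
    using C N gu by (intro sum.mono_neutral_left) auto
  also have "\<dots> = (\<Sum>c\<in>N. g c u * h (e c))"
    using C N by (intro sum.mono_neutral_right) auto
  finally show ?thesis .
qed

section \<open>Identities for dual homogeneous bases\<close>

locale graded_dual_bases = quadratic_graded_perm_algebra scale G circ \<omega>
  for scale :: "'k::field \<Rightarrow> 'b::ab_group_add \<Rightarrow> 'b" and G :: "int \<Rightarrow> 'b set"
    and circ :: "'b \<Rightarrow> 'b \<Rightarrow> 'b" and \<omega> :: "'b \<Rightarrow> 'b \<Rightarrow> 'k" +
  fixes \<Omega> :: "'j set" and e f :: "'j \<Rightarrow> 'b"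
  assumes dual_bases: "dual_homogeneous_bases \<Omega> e f"
begin

lemma span_bases: "span (e ` \<Omega>) = UNIV" "span (f ` \<Omega>) = UNIV"
  and homogeneous: "c \<in> \<Omega> \<Longrightarrow> \<exists>d. e c \<in> G d" "c \<in> \<Omega> \<Longrightarrow> \<exists>d. f c \<in> G d"
  and pairing: "c \<in> \<Omega> \<Longrightarrow> d \<in> \<Omega> \<Longrightarrow> \<omega> (f c) (e d) = (if c = d then 1 else 0)"
  using dual_bases by (auto simp: dual_homogeneous_bases_def homogeneous_basis_def)

lemma \<omega>_linear: "linear_on scale UNIV (*) (\<omega> u)" "linear_on scale UNIV (*) (\<lambda>u. \<omega> u v)"
  using \<omega>_bilinear by (simp_all add: bilinear_on_def)

lemma \<omega>_simps:
  "\<omega> (u + u') v = \<omega> u v + \<omega> u' v" "\<omega> v (u + u') = \<omega> v u + \<omega> v u'"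
  "\<omega> (scale k u) v = k * \<omega> u v" "\<omega> v (scale k u) = k * \<omega> v u"
  using \<omega>_bilinear by (simp_all add: bilinear_on_def linear_on_def)

lemma \<omega>_zero: "\<omega> 0 v = 0" "\<omega> v 0 = 0"
  using \<omega>_simps(3)[of 0 0 v] \<omega>_simps(4)[of v 0 0] by simp_all

lemma \<omega>_diff: "\<omega> v (u - u') = \<omega> v u - \<omega> v u'"
  using \<omega>_simps(2)[of v "u - u'" u'] by simp

text \<open>The right-hand side of the invariance axiom changes sign when \<open>b\<close> and
  \<open>c\<close> are exchanged, hence
  \<open>\<omega> (circ u v) w = - \<omega> (circ u w) v\<close>; skew-symmetry of
  \<open>\<omega>\<close> gives the rest.\<close>

lemma \<omega>_left_invariant: "\<omega> (circ u v) w = \<omega> v (circ u w)"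
  using \<omega>_invariant[of u v w] \<omega>_invariant[of u w v] \<omega>_skew[of v "circ u w"]
  by (simp add: \<omega>_diff)

lemma e_expansion:
  assumes "linear_on scale UNIV (*) h" "finite N" "N \<subseteq> \<Omega>"
    "\<And>c. c \<in> \<Omega> - N \<Longrightarrow> \<omega> (f c) u * h (e c) = 0"
  shows "h u = (\<Sum>c\<in>N. \<omega> (f c) u * h (e c))"
  by (rule dual_family_expansion[OF span_bases(1) \<omega>_linear(1) pairing assms])

lemma f_expansion:
  assumes "linear_on scale UNIV (*) h" "finite N" "N \<subseteq> \<Omega>"
    "\<And>c. c \<in> \<Omega> - N \<Longrightarrow> \<omega> u (e c) * h (f c) = 0"
  shows "h u = (\<Sum>c\<in>N. \<omega> u (e c) * h (f c))"
proof -
  have "\<omega> (f d) (e c) = (if c = d then 1 else 0)" if "c \<in> \<Omega>" "d \<in> \<Omega>" for c d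
    using pairing[OF that(2,1)] by auto
  from dual_family_expansion[OF span_bases(2) \<omega>_linear(2) this assms] show ?thesis .
qed

text \<open>The choice is unambiguous on \<open>\<Omega>\<close>: the basis vectors are homogeneous
  and nonzero, so their degrees are unique. The pair is the bidegree at which an index contributes
  to \<open>induced_r\<close>.\<close>

definition index_degree :: "'j \<Rightarrow> int \<times> int"
  where "index_degree c = (SOME d. e c \<in> G (fst d) \<and> f c \<in> G (snd d))"

lemma degree_unique: "u \<in> G k \<Longrightarrow> u \<in> G l \<Longrightarrow> u \<noteq> 0 \<Longrightarrow> k = l"
  using component_homogeneous[of u k k] component_homogeneous[of u l k] by (auto split: if_splits)

lemma basis_nonzero: "c \<in> \<Omega> \<Longrightarrow> e c \<noteq> 0" "c \<in> \<Omega> \<Longrightarrow> f c \<noteq> 0"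
  using pairing[of c c] \<omega>_zero by fastforce+

lemma in_degree_iff:
  assumes "c \<in> \<Omega>"
  shows "e c \<in> G k \<longleftrightarrow> fst (index_degree c) = k" "f c \<in> G l \<longleftrightarrow> snd (index_degree c) = l"
proof -
  obtain k' l' where "e c \<in> G k'" "f c \<in> G l'" using homogeneous assms by blast
  then have "e c \<in> G (fst (k', l')) \<and> f c \<in> G (snd (k', l'))" by simp
  then have "e c \<in> G (fst (index_degree c)) \<and> f c \<in> G (snd (index_degree c))"
    unfolding index_degree_def by (rule someI)
  then show "e c \<in> G k \<longleftrightarrow> fst (index_degree c) = k" "f c \<in> G l \<longleftrightarrow> snd (index_degree c) = l"
    using degree_unique basis_nonzero[OF assms] by blast+
qed

lemma index_set: "{c\<in>\<Omega>. e c \<in> G k \<and> f c \<in> G l} = {c\<in>\<Omega>. index_degree c = (k, l)}"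
  using in_degree_iff by (auto simp: prod_eq_iff)

lemma finite_index_set: "finite {c\<in>\<Omega>. index_degree c = d}"
  using finite_degree_terms[OF dual_bases] unfolding index_set by (metis surj_pair)

section \<open>Saturated index sets and the Casimir element\<close>

definition supports :: "'j set \<Rightarrow> ('b \<Rightarrow> 'k) \<Rightarrow> bool"
  where "supports N h \<longleftrightarrow> (\<forall>c\<in>\<Omega> - N. h (e c) = 0 \<and> h (f c) = 0)"

text \<open>
  Saturation says that \<open>f b\<close>, for \<open>b \<in> N\<close>, is a combination of the \<open>e c\<close> with \<open>c \<in> N\<close>. So the sum
  over \<open>N\<close> of the \<open>e c \<otimes> f c\<close> is skew-symmetric as soon as one of its two factors is evaluated at a
  form supported on \<open>N\<close>.
\<close>

definition saturated :: "'j set \<Rightarrow> bool"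
  where "saturated N \<longleftrightarrow> finite N \<and> N \<subseteq> \<Omega> \<and> (\<forall>b\<in>N. \<forall>c\<in>\<Omega> - N. \<omega> (f c) (f b) = 0)"

lemma saturatedD:
  assumes "saturated N"
  shows "finite N" "N \<subseteq> \<Omega>" "b \<in> N \<Longrightarrow> c \<in> \<Omega> - N \<Longrightarrow> \<omega> (f c) (f b) = 0"
  using assms by (auto simp: saturated_def)

text \<open>\<open>\<omega>\<close> pairs only degrees adding up to \<open>- m\<close>. Since
  \<open>\<omega> (f c) (e c) = 1\<close>, the degrees of \<open>e c\<close> and \<open>f c\<close>
  determine each other, so the indices with one of them in \<open>D\<close> lie in finitely many
  bidegrees, each of which has finitely many indices.\<close>

lemma ex_saturated:
  assumes "finite D"
  obtains N where "saturated N"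
    "\<And>i h. i \<in> D \<Longrightarrow> h 0 = 0 \<Longrightarrow> supports N (\<lambda>u. h (component i u))"
proof -
  obtain m where m: "\<And>i j a b. i + j + m \<noteq> 0 \<Longrightarrow> a \<in> G i \<Longrightarrow> b \<in> G j \<Longrightarrow> \<omega> a b = 0"
    using \<omega>_graded by blast
  let ?de = "\<lambda>c. fst (index_degree c)" and ?df = "\<lambda>c. snd (index_degree c)"
  have deg: "?df c + ?de c + m = 0" if "c \<in> \<Omega>" for c
    using m[of "?df c" "?de c" "f c" "e c"] pairing[OF that that] in_degree_iff[OF that] by fastforce
  have degf: "?df c + ?df b + m = 0" if "c \<in> \<Omega>" "b \<in> \<Omega>" "\<omega> (f c) (f b) \<noteq> 0" for b c
    using m[of "?df c" "?df b" "f c" "f b"] that in_degree_iff by blast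
  define N where "N = {c\<in>\<Omega>. ?de c \<in> D \<or> ?df c \<in> D}"
  have "N \<subseteq> (\<Union>i\<in>D. {c\<in>\<Omega>. index_degree c = (i, - m - i)} \<union> {c\<in>\<Omega>. index_degree c = (- m - i, i)})"
  proof
    fix c assume c: "c \<in> N"
    then have "index_degree c = (?de c, - m - ?de c)" "index_degree c = (- m - ?df c, ?df c)"
      using deg[of c] by (auto simp: N_def prod_eq_iff)
    then show "c \<in> (\<Union>i\<in>D. {c\<in>\<Omega>. index_degree c = (i, - m - i)} \<union> {c\<in>\<Omega>. index_degree c = (- m - i, i)})"
      using c unfolding N_def by blast
  qed
  then have "finite N"
    by (rule finite_subset) (use assms finite_index_set in auto)
  moreover have "\<omega> (f c) (f b) = 0" if "b \<in> N" "c \<in> \<Omega> - N" for b c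
  proof (rule ccontr)
    assume "\<omega> (f c) (f b) \<noteq> 0"
    \<comment> \<open>A nonzero pairing of \<open>f c\<close> and \<open>f b\<close> forces
      \<open>f c\<close> to have the degree of \<open>e b\<close>, and \<open>f b\<close> that of
      \<open>e c\<close>. As \<open>N\<close> looks at both degrees of an index, \<open>b\<close>
      and \<open>c\<close> lie in it together.\<close>
    then have "?df c + ?df b + m = 0" using degf that by (auto simp: N_def)
    then have "?de c = ?df b" "?df c = ?de b" using deg[of b] deg[of c] that by (auto simp: N_def)
    then show False using that by (auto simp: N_def)
  qed
  ultimately have "saturated N" by (auto simp: saturated_def N_def)
  moreover have "supports N (\<lambda>u. h (component i u))" if "i \<in> D" "h 0 = 0" for i and h :: "'b \<Rightarrow> 'k"
    unfolding supports_def
  proof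
    fix c assume "c \<in> \<Omega> - N"
    then have c: "c \<in> \<Omega>" "?de c \<noteq> i" "?df c \<noteq> i" using that by (auto simp: N_def)
    then have "component i (e c) = 0" "component i (f c) = 0"
      using component_homogeneous[of "e c" "?de c"] component_homogeneous[of "f c" "?df c"]
        in_degree_iff[OF c(1)] by auto
    then show "h (component i (e c)) = 0 \<and> h (component i (f c)) = 0" using that by simp
  qed
  ultimately show ?thesis using that by blast
qed

text \<open>Expand \<open>f c\<close> in the \<open>e b\<close> with coefficients
  \<open>\<omega> (f b) (f c)\<close>. After exchanging the sums, skew-symmetry of
  \<open>\<omega>\<close> makes the sum over \<open>c\<close> the negative of the expansion of
  \<open>f b\<close> in the first argument.\<close>

lemma casimir_skew:
  assumes N: "saturated N"
    and \<beta>: "\<And>v. linear_on scale UNIV (*) (\<lambda>u. \<beta> u v)" "\<And>u. linear_on scale UNIV (*) (\<beta> u)"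
    and sup: "\<And>v. supports N (\<lambda>u. \<beta> u v)"
  shows "(\<Sum>c\<in>N. \<beta> (e c) (f c)) = - (\<Sum>c\<in>N. \<beta> (f c) (e c))"
proof -
  note N' = saturatedD[OF N]
  have "(\<Sum>c\<in>N. \<beta> (e c) (f c)) = (\<Sum>c\<in>N. \<Sum>b\<in>N. \<omega> (f b) (f c) * \<beta> (e c) (e b))"
    using N' by (intro sum.cong refl e_expansion \<beta>) auto
  also have "\<dots> = (\<Sum>b\<in>N. \<Sum>c\<in>N. \<omega> (f b) (f c) * \<beta> (e c) (e b))"
    by (rule sum.swap)
  also have "\<dots> = (\<Sum>b\<in>N. - \<beta> (f b) (e b))"
  proof (intro sum.cong refl)
    fix b assume b: "b \<in> N"
    have "\<beta> (f b) (e b) = (\<Sum>c\<in>N. \<omega> (f c) (f b) * \<beta> (e c) (e b))"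
      using N' sup by (intro e_expansion \<beta>) (auto simp: supports_def)
    then show "(\<Sum>c\<in>N. \<omega> (f b) (f c) * \<beta> (e c) (e b)) = - \<beta> (f b) (e b)"
      by (simp add: \<omega>_skew[of "f b"] sum_negf)
  qed
  finally show ?thesis by (simp add: sum_negf)
qed

text \<open>In the coefficients \<open>\<omega> (circ (f c) b) (e a)\<close> of the expansion in the
  \<open>f a\<close>, invariance of \<open>\<omega>\<close> moves \<open>b\<close> onto
  \<open>e a\<close> as a commutator; the sum over \<open>c\<close> is then an expansion in the
  \<open>e c\<close>.\<close>

lemma casimir_invariant:
  assumes N: "saturated N"
    and \<beta>: "\<And>v. linear_on scale UNIV (*) (\<lambda>u. \<beta> u v)" "\<And>u. linear_on scale UNIV (*) (\<beta> u)"
    and sup: "\<And>v. supports N (\<lambda>u. \<beta> u v)" "\<And>u. supports N (\<beta> u)"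
  shows "(\<Sum>c\<in>N. \<beta> (e c) (circ (f c) b)) = (\<Sum>c\<in>N. \<beta> (circ b (e c) - circ (e c) b) (f c))"
proof -
  note N' = saturatedD[OF N]
  have "(\<Sum>c\<in>N. \<beta> (e c) (circ (f c) b)) = (\<Sum>c\<in>N. \<Sum>a\<in>N. \<omega> (circ (f c) b) (e a) * \<beta> (e c) (f a))"
    using N' sup by (intro sum.cong refl f_expansion \<beta>) (auto simp: supports_def)
  also have "\<dots> = (\<Sum>a\<in>N. \<Sum>c\<in>N. \<omega> (f c) (circ b (e a) - circ (e a) b) * \<beta> (e c) (f a))"
    unfolding \<omega>_invariant by (rule sum.swap)
  also have "\<dots> = (\<Sum>a\<in>N. \<beta> (circ b (e a) - circ (e a) b) (f a))"
    using N' sup by (intro sum.cong refl e_expansion[symmetric] \<beta>) (auto simp: supports_def)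
  finally show ?thesis .
qed

section \<open>Contractions of two Casimir elements with a trilinear form\<close>

context
  fixes N :: "'j set" and \<Theta> :: "'b \<Rightarrow> 'b \<Rightarrow> 'b \<Rightarrow> 'k"
  assumes N: "saturated N"
    and lin: "\<And>v w. linear_on scale UNIV (*) (\<lambda>u. \<Theta> u v w)" "\<And>u w. linear_on scale UNIV (*) (\<lambda>v. \<Theta> u v w)"
      "\<And>u v. linear_on scale UNIV (*) (\<Theta> u v)"
    and sup: "\<And>v w. supports N (\<lambda>u. \<Theta> u v w)" "\<And>u w. supports N (\<lambda>v. \<Theta> u v w)"
      "\<And>u v. supports N (\<Theta> u v)"
begin

lemma form_expansion:
  "\<Theta> u v w = (\<Sum>a\<in>N. \<omega> (f a) u * \<Theta> (e a) v w)"
  "\<Theta> u v w = (\<Sum>b\<in>N. \<omega> v (e b) * \<Theta> u (f b) w)"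
  "\<Theta> u v w = (\<Sum>c\<in>N. \<omega> w (e c) * \<Theta> u v (f c))"
proof -
  note N' = saturatedD(1,2)[OF N]
  have out: "\<Theta> (e a) v w = 0" "\<Theta> u (f a) w = 0" "\<Theta> u v (f a) = 0"
    if "a \<in> \<Omega> - N" for a u v w
    using that sup unfolding supports_def by blast+
  show "\<Theta> u v w = (\<Sum>a\<in>N. \<omega> (f a) u * \<Theta> (e a) v w)"
    by (rule e_expansion[OF lin(1) N']) (simp add: out)
  show "\<Theta> u v w = (\<Sum>b\<in>N. \<omega> v (e b) * \<Theta> u (f b) w)"
    by (rule f_expansion[OF lin(2) N']) (simp add: out)
  show "\<Theta> u v w = (\<Sum>c\<in>N. \<omega> w (e c) * \<Theta> u v (f c))"
    by (rule f_expansion[OF lin(3) N']) (simp add: out)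
qed

lemma triple_sum_rotate:
  "(\<Sum>b\<in>N. \<Sum>c\<in>N. \<Sum>a\<in>N. h a b c) = (\<Sum>a\<in>N. \<Sum>b\<in>N. \<Sum>c\<in>N. (h a b c :: 'k))"
proof -
  have "(\<Sum>b\<in>N. \<Sum>c\<in>N. \<Sum>a\<in>N. h a b c) = (\<Sum>b\<in>N. \<Sum>a\<in>N. \<Sum>c\<in>N. h a b c)"
    by (rule sum.cong[OF refl], rule sum.swap)
  also have "\<dots> = (\<Sum>a\<in>N. \<Sum>b\<in>N. \<Sum>c\<in>N. h a b c)" by (rule sum.swap)
  finally show ?thesis .
qed

text \<open>\<open>casimir_skew\<close> is applied to the second and third arguments, its support
  condition being met by the second. It provides the factor \<open>f b\<close> in second place that
  \<open>normal_form\<close> asks for.\<close>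

lemma casimir_in_form:
  "(\<Sum>b\<in>N. \<Theta> u (e b) (circ v (f b))) = - (\<Sum>b\<in>N. \<Theta> u (f b) (circ v (e b)))"
  "(\<Sum>b\<in>N. \<Theta> u (e b) (circ (f b) v)) = - (\<Sum>b\<in>N. \<Theta> u (f b) (circ (e b) v))"
proof -
  have "linear_on scale UNIV (*) (\<lambda>w. \<Theta> u u' (circ v w))" "linear_on scale UNIV (*) (\<lambda>w. \<Theta> u u' (circ w v))" for u'
    using lin(3) circ_bilinear by (simp_all add: linear_on_def bilinear_on_def)
  note this' = casimir_skew[OF N lin(2) this(1) sup(2)] casimir_skew[OF N lin(2) this(2) sup(2)]
  show "(\<Sum>b\<in>N. \<Theta> u (e b) (circ v (f b))) = - (\<Sum>b\<in>N. \<Theta> u (f b) (circ v (e b)))"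
    "(\<Sum>b\<in>N. \<Theta> u (e b) (circ (f b) v)) = - (\<Sum>b\<in>N. \<Theta> u (f b) (circ (e b) v))"
    by (rule this')+
qed

text \<open>All contractions are expanded along \<open>e a\<close>, \<open>f b\<close>,
  \<open>f c\<close>, so that relations between them reduce to identities of \<open>\<omega>\<close>
  for the coefficients \<open>g\<close>.\<close>

definition normal_form :: "('j \<Rightarrow> 'j \<Rightarrow> 'j \<Rightarrow> 'k) \<Rightarrow> 'k"
  where "normal_form g = (\<Sum>a\<in>N. \<Sum>b\<in>N. \<Sum>c\<in>N. g a b c * \<Theta> (e a) (f b) (f c))"

lemma normal_form_diff: "normal_form (\<lambda>a b c. g a b c - g' a b c) = normal_form g - normal_form g'"
  by (simp add: normal_form_def left_diff_distrib sum_subtractf)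

lemma normal_form_first:
  "(\<Sum>a\<in>N. \<Sum>b\<in>N. \<Theta> (circ (e a) (e b)) (f a) (f b)) = normal_form (\<lambda>a b c. \<omega> (f a) (circ (e b) (e c)))"
  unfolding normal_form_def
  by (rule trans[OF _ triple_sum_rotate], (rule sum.cong[OF refl])+, rule form_expansion(1))

lemma normal_form_first_flip:
  "(\<Sum>a\<in>N. \<Sum>b\<in>N. \<Theta> (circ (e a) (e b)) (f b) (f a)) = normal_form (\<lambda>a b c. \<omega> (f a) (circ (e c) (e b)))"
proof -
  have "(\<Sum>a\<in>N. \<Sum>b\<in>N. \<Theta> (circ (e a) (e b)) (f b) (f a)) = (\<Sum>b\<in>N. \<Sum>c\<in>N. \<Theta> (circ (e c) (e b)) (f b) (f c))"
    by (rule sum.swap)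
  also have "\<dots> = normal_form (\<lambda>a b c. \<omega> (f a) (circ (e c) (e b)))"
    unfolding normal_form_def
    by (rule trans[OF _ triple_sum_rotate], (rule sum.cong[OF refl])+, rule form_expansion(1))
  finally show ?thesis .
qed

text \<open>By invariance the coefficient \<open>\<omega> (circ (f a) (e c)) (e b)\<close> is a
  commutator inside \<open>\<omega> (f a)\<close>, whose two halves are the coefficients of
  \<open>M'\<close> and \<open>M\<close>.\<close>

lemma second_position:
  "(\<Sum>a\<in>N. \<Sum>b\<in>N. \<Theta> (e a) (circ (f a) (e b)) (f b))
    = (\<Sum>a\<in>N. \<Sum>b\<in>N. \<Theta> (circ (e a) (e b)) (f b) (f a))
      - (\<Sum>a\<in>N. \<Sum>b\<in>N. \<Theta> (circ (e a) (e b)) (f a) (f b))"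
proof -
  have "(\<Sum>a\<in>N. \<Sum>b\<in>N. \<Theta> (e a) (circ (f a) (e b)) (f b))
      = (\<Sum>a\<in>N. \<Sum>c\<in>N. \<Sum>b\<in>N. \<omega> (circ (f a) (e c)) (e b) * \<Theta> (e a) (f b) (f c))"
    by (intro sum.cong refl) (rule form_expansion(2))
  also have "\<dots> = normal_form (\<lambda>a b c. \<omega> (circ (f a) (e c)) (e b))"
    unfolding normal_form_def by (rule sum.cong[OF refl], rule sum.swap)
  finally show ?thesis
    unfolding \<omega>_invariant \<omega>_diff normal_form_diff normal_form_first normal_form_first_flip .
qed

text \<open>Flipping one Casimir element costs a sign. The commutator obtained from invariance is
  the opposite of the one for \<open>second_position\<close>, so the two results agree.\<close>

lemma third_position:
  "(\<Sum>a\<in>N. \<Sum>b\<in>N. \<Theta> (e a) (e b) (circ (f a) (f b)))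
    = (\<Sum>a\<in>N. \<Sum>b\<in>N. \<Theta> (circ (e a) (e b)) (f b) (f a))
      - (\<Sum>a\<in>N. \<Sum>b\<in>N. \<Theta> (circ (e a) (e b)) (f a) (f b))"
proof -
  have "(\<Sum>a\<in>N. \<Sum>b\<in>N. \<Theta> (e a) (e b) (circ (f a) (f b)))
      = - (\<Sum>a\<in>N. \<Sum>b\<in>N. \<Theta> (e a) (f b) (circ (f a) (e b)))"
    unfolding casimir_in_form(1) by (rule sum_negf)
  also have "(\<Sum>a\<in>N. \<Sum>b\<in>N. \<Theta> (e a) (f b) (circ (f a) (e b)))
      = normal_form (\<lambda>a b c. \<omega> (circ (f a) (e b)) (e c))"
    unfolding normal_form_def by (intro sum.cong refl) (rule form_expansion(3))
  finally show ?thesis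
    unfolding \<omega>_invariant \<omega>_diff normal_form_diff normal_form_first normal_form_first_flip by simp
qed

text \<open>Here the factor \<open>e a\<close> multiplies from the left, so
  \<open>\<omega>_left_invariant\<close> applies and yields a single term instead of a
  commutator.\<close>

lemma second_position_flip:
  "(\<Sum>a\<in>N. \<Sum>b\<in>N. \<Theta> (e b) (circ (e a) (f b)) (f a))
    = (\<Sum>a\<in>N. \<Sum>b\<in>N. \<Theta> (circ (e a) (e b)) (f b) (f a))"
proof -
  have "(\<Sum>a\<in>N. \<Sum>b\<in>N. \<Theta> (e b) (circ (e a) (f b)) (f a))
      = (\<Sum>c\<in>N. \<Sum>a\<in>N. \<Sum>b\<in>N. \<omega> (circ (e c) (f a)) (e b) * \<Theta> (e a) (f b) (f c))"
    by (intro sum.cong refl) (rule form_expansion(2))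
  also have "\<dots> = normal_form (\<lambda>a b c. \<omega> (circ (e c) (f a)) (e b))"
    unfolding normal_form_def by (rule triple_sum_rotate[symmetric])
  finally show ?thesis
    unfolding \<omega>_left_invariant normal_form_first_flip .
qed

text \<open>Left invariance again leaves one term; the sign comes from flipping one Casimir
  element.\<close>

lemma third_position_flip:
  "(\<Sum>a\<in>N. \<Sum>b\<in>N. \<Theta> (e b) (e a) (circ (f a) (f b)))
    = - (\<Sum>a\<in>N. \<Sum>b\<in>N. \<Theta> (circ (e a) (e b)) (f a) (f b))"
proof -
  have "(\<Sum>a\<in>N. \<Sum>b\<in>N. \<Theta> (e b) (e a) (circ (f a) (f b)))
      = (\<Sum>b\<in>N. \<Sum>a\<in>N. \<Theta> (e b) (e a) (circ (f a) (f b)))"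
    by (rule sum.swap)
  also have "\<dots> = - (\<Sum>b\<in>N. \<Sum>a\<in>N. \<Theta> (e b) (f a) (circ (e a) (f b)))"
    unfolding casimir_in_form(2) by (rule sum_negf)
  also have "(\<Sum>b\<in>N. \<Sum>a\<in>N. \<Theta> (e b) (f a) (circ (e a) (f b)))
      = normal_form (\<lambda>a b c. \<omega> (circ (e b) (f a)) (e c))"
    unfolding normal_form_def by (intro sum.cong refl) (rule form_expansion(3))
  finally show ?thesis
    unfolding \<omega>_left_invariant normal_form_first .
qed

end

end


section \<open>Multilinear forms on the Poisson side\<close>

lemma sum_fun_apply: "(\<Sum>i\<in>I. g i) z = (\<Sum>i\<in>I. g i z)"
  for g :: "'i \<Rightarrow> 'z \<Rightarrow> 'c::comm_monoid_add"
  by (induction I rule: infinite_finite_induct) auto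

lemma sum_swap_pairs:
  "(\<Sum>a\<in>A. \<Sum>b\<in>B. \<Sum>i\<in>I. \<Sum>j\<in>J. h a b i j) = (\<Sum>i\<in>I. \<Sum>j\<in>J. \<Sum>a\<in>A. \<Sum>b\<in>B. h a b i j)"
  using sum.swap[of "\<lambda>w z. h (fst w) (snd w) (fst z) (snd z)" "I \<times> J" "A \<times> B"]
  by (simp add: sum.cartesian_product')

lemma tens3_simps:
  assumes "x \<in> V" "x' \<in> V" "y \<in> V" "z \<in> V"
  shows "tens3 s V (x + x') y z = tens3 s V x y z + tens3 s V x' y z"
    "tens3 s V y (x + x') z = tens3 s V y x z + tens3 s V y x' z"
    "tens3 s V y z (x + x') = tens3 s V y z x + tens3 s V y z x'"
    "tens3 s V (s c x) y z = fscale c (tens3 s V x y z)"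
    "tens3 s V y (s c x) z = fscale c (tens3 s V y x z)"
    "tens3 s V y z (s c x) = fscale c (tens3 s V y z x)"
  using assms by (auto simp: tens3_def trilinear_on_def linear_on_def fscale_def fun_eq_iff)

text \<open>One clause for each shape of term in the PoiYBE and the DPYBE;
  \<open>tensor_lift2_sum\<close> then evaluates these equations on sums of pure tensors.\<close>

lemma quadrilinear_tens3:
  assumes s: "vector_space s" "module.subspace s V"
    and m: "bilinear_on s V s V s m" and closed: "\<And>x y. x \<in> V \<Longrightarrow> y \<in> V \<Longrightarrow> m x y \<in> V"
  shows "quadrilinear_on s V s V (\<lambda>x y x' y'. tens3 s V (m x x') y y')"
    "quadrilinear_on s V s V (\<lambda>x y x' y'. tens3 s V (m x x') y' y)"
    "quadrilinear_on s V s V (\<lambda>x y x' y'. tens3 s V x (m y x') y')"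
    "quadrilinear_on s V s V (\<lambda>x y x' y'. tens3 s V x' (m x y') y)"
    "quadrilinear_on s V s V (\<lambda>x y x' y'. tens3 s V x x' (m y y'))"
    "quadrilinear_on s V s V (\<lambda>x y x' y'. tens3 s V x' x (m y y'))"
proof -
  interpret vector_space s by fact
  have m': "m (x + x') y = m x y + m x' y" "m y (x + x') = m y x + m y x'"
    "m (s c x) y = s c (m x y)" "m y (s c x) = s c (m y x)"
    if "x \<in> V" "x' \<in> V" "y \<in> V" for x x' y c
    using m that by (simp_all add: bilinear_on_def linear_on_def)
  note rules = quadrilinear_on_def bilinear_on_def linear_on_def tens3_simps m' closed
    subspace_add[OF s(2)] subspace_scale[OF s(2)]
  show "quadrilinear_on s V s V (\<lambda>x y x' y'. tens3 s V (m x x') y y')"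
    "quadrilinear_on s V s V (\<lambda>x y x' y'. tens3 s V (m x x') y' y)"
    "quadrilinear_on s V s V (\<lambda>x y x' y'. tens3 s V x (m y x') y')"
    "quadrilinear_on s V s V (\<lambda>x y x' y'. tens3 s V x' (m x y') y)"
    "quadrilinear_on s V s V (\<lambda>x y x' y'. tens3 s V x x' (m y y'))"
    "quadrilinear_on s V s V (\<lambda>x y x' y'. tens3 s V x' x (m y y'))"
    by (simp_all add: rules)
qed

lemma quadrilinear_add:
  assumes "quadrilinear_on s V t W F" "quadrilinear_on s V t W F'"
  shows "quadrilinear_on s V t W (\<lambda>x y x' y'. F x y x' y' + F' x y x' y')"
    "quadrilinear_on s V t W (\<lambda>x y x' y'. F x y x' y' - F' x y x' y')"
  using assms
  by (simp_all add: quadrilinear_on_def bilinear_on_def linear_on_def fvs.scale_right_distrib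
      fvs.scale_right_diff_distrib)

text \<open>The tensor equations are evaluated at \<open>\<Theta>\<close>. In the first, exchanging
  \<open>i\<close> and \<open>j\<close> and commutativity of \<open>mul\<close> bring the third term
  into the same shape as in the second equation.\<close>

lemma (in poisson_algebra) poiybe_form:
  assumes I: "finite I" and r: "r = (\<Sum>i\<in>I. tens scale UNIV scale UNIV (x i) (y i))"
    and sol: "poiybe_solution r" and \<Theta>: "trilinear_on scale UNIV (*) \<Theta>"
  shows "(\<Sum>i\<in>I. \<Sum>j\<in>I. \<Theta> (mul (x i) (x j)) (y i) (y j) + \<Theta> (x i) (x j) (mul (y i) (y j))
      - \<Theta> (x i) (mul (y i) (x j)) (y j)) = 0"
    "(\<Sum>i\<in>I. \<Sum>j\<in>I. \<Theta> (br (x i) (x j)) (y i) (y j) + \<Theta> (x i) (x j) (br (y i) (y j))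
      + \<Theta> (x i) (br (y i) (x j)) (y j)) = 0"
proof -
  interpret subspace_pair scale UNIV scale UNIV by unfold_locales auto
  note quad = quadrilinear_tens3[OF vs(1,2) mul_bilinear] quadrilinear_tens3[OF vs(1,2) br_bilinear]
  have "poiybe_A r = (\<Sum>i\<in>I. \<Sum>j\<in>I. ptens3 (mul (x i) (x j)) (y i) (y j) + ptens3 (x i) (x j) (mul (y i) (y j))
      - ptens3 (x j) (mul (x i) (y j)) (y i))"
    unfolding poiybe_A_def r by (intro tensor_lift2_sum I quadrilinear_add quad) auto
  then have "(\<Sum>i\<in>I. \<Sum>j\<in>I. ptens3 (mul (x i) (x j)) (y i) (y j) + ptens3 (x i) (x j) (mul (y i) (y j))
      - ptens3 (x j) (mul (x i) (y j)) (y i)) \<Theta> = 0"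
    using sol by (simp add: poiybe_solution_def)
  then have "(\<Sum>i\<in>I. \<Sum>j\<in>I. \<Theta> (mul (x i) (x j)) (y i) (y j) + \<Theta> (x i) (x j) (mul (y i) (y j))
      - \<Theta> (x j) (mul (x i) (y j)) (y i)) = 0"
    by (simp add: sum_fun_apply tens3_def \<Theta>)
  moreover have "(\<Sum>i\<in>I. \<Sum>j\<in>I. \<Theta> (x j) (mul (x i) (y j)) (y i)) = (\<Sum>i\<in>I. \<Sum>j\<in>I. \<Theta> (x i) (mul (y i) (x j)) (y j))"
    by (subst sum.swap) (simp add: mul_commute)
  ultimately show "(\<Sum>i\<in>I. \<Sum>j\<in>I. \<Theta> (mul (x i) (x j)) (y i) (y j) + \<Theta> (x i) (x j) (mul (y i) (y j))
      - \<Theta> (x i) (mul (y i) (x j)) (y j)) = 0"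
    by (simp add: sum_subtractf)
  have "poiybe_C r = (\<Sum>i\<in>I. \<Sum>j\<in>I. ptens3 (br (x i) (x j)) (y i) (y j) + ptens3 (x i) (x j) (br (y i) (y j))
      + ptens3 (x i) (br (y i) (x j)) (y j))"
    unfolding poiybe_C_def r by (intro tensor_lift2_sum I quadrilinear_add quad) auto
  then have "(\<Sum>i\<in>I. \<Sum>j\<in>I. ptens3 (br (x i) (x j)) (y i) (y j) + ptens3 (x i) (x j) (br (y i) (y j))
      + ptens3 (x i) (br (y i) (x j)) (y j)) \<Theta> = 0"
    using sol by (simp add: poiybe_solution_def)
  then show "(\<Sum>i\<in>I. \<Sum>j\<in>I. \<Theta> (br (x i) (x j)) (y i) (y j) + \<Theta> (x i) (x j) (br (y i) (y j))
      + \<Theta> (x i) (br (y i) (x j)) (y j)) = 0"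
    by (simp add: sum_fun_apply tens3_def \<Theta>)
qed

section \<open>The induced algebra and forms localised at finitely many basis indices\<close>

sublocale induced_setting \<subseteq> dpp: graded_dpp_algebra fscale A circ ast
  by (rule induced_dpp_algebra)

sublocale induced_setting \<subseteq> TT: subspace_pair fscale "tensor_space sP UNIV sB UNIV" fscale "tensor_space sP UNIV sB UNIV"
  by unfold_locales (auto simp: tensor_space_def)

locale induced_r_setting = induced_setting sP mul br sB G circB
    + q: graded_dual_bases sB G circB \<omega> \<Omega> e f
  for sP :: "'k::field \<Rightarrow> 'p::ab_group_add \<Rightarrow> 'p" and mul br
    and sB :: "'k \<Rightarrow> 'b::ab_group_add \<Rightarrow> 'b" and G circB \<omega>
    and \<Omega> :: "'j set" and e f
begin

abbreviation tt where "tt \<equiv> tens fscale T fscale T"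

text \<open>Tensoring the homogeneous decomposition of \<open>u\<close> with \<open>p\<close> gives
  parts in the spaces \<open>A j\<close>, and homogeneous decompositions are unique.\<close>

lemma tensor_component: "gr.component i (tn p u) = tn p (b.component i u)"
proof (rule gr.component_eqI)
  have u: "u \<in> b.total" by (simp add: b.total_UNIV)
  note c = b.component_props[OF u]
  have tn0: "tn p 0 = 0" using tens_simps(4)[of p 0 0] by (simp add: fun_eq_iff fscale_def)
  show "tn p (b.component j u) \<in> A j" for j
    unfolding induced_grading_def using c(1) by (intro fvs.span_base) blast
  show "finite {j. tn p (b.component j u) \<noteq> 0}"
    using c(2) by (rule rev_finite_subset) (use tn0 in auto)
  have sum: "tn p (\<Sum>j\<in>J. b.component j u) = (\<Sum>j\<in>J. tn p (b.component j u))" for J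
    by (induction J rule: infinite_finite_induct) (simp_all add: tn0 tens_simps(2) del: plus_fun_apply zero_fun_apply)
  have "tn p u = tn p (\<Sum>j | b.component j u \<noteq> 0. b.component j u)"
    using c(3) by (simp add: Sum_any.expand_set)
  also have "\<dots> = Sum_any (\<lambda>j. tn p (b.component j u))"
    unfolding sum using c(2) tn0 by (intro Sum_any.expand_superset[symmetric]) auto
  finally show "tn p u = Sum_any (\<lambda>j. tn p (b.component j u))" .
qed

lemma tensor_zero: "tn p 0 = 0"
  using tens_simps(4)[of p 0 0] by (simp add: fun_eq_iff fscale_def)

lemma tens_diff_right: "tn p (u - v) = tn p u - tn p v"
  using tens_simps(2)[of p "u - v" v] by (simp add: algebra_simps del: plus_fun_apply)

lemma component_in_T: "u \<in> T \<Longrightarrow> gr.component i u \<in> T"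
  using gr.component_props(1) A_subset_T total_eq_T by blast

lemma component_add: "u \<in> T \<Longrightarrow> v \<in> T \<Longrightarrow> gr.component i (u + v) = gr.component i u + gr.component i v"
  and component_scale: "u \<in> T \<Longrightarrow> gr.component i (fscale c u) = fscale c (gr.component i u)"
  using gr.component_linear[of i] by (simp_all add: linear_on_def total_eq_T)

text \<open>Models a trilinear form preceded by the projections to a fixed degree: in each slot, its
  \<open>B\<close>-part only sees the basis vectors with index in \<open>N\<close>.\<close>

definition localised :: "'j set \<Rightarrow> (('k, 'p, 'b) tensor \<Rightarrow> ('k, 'p, 'b) tensor \<Rightarrow> ('k, 'p, 'b) tensor \<Rightarrow> 'k) \<Rightarrow> bool"
  where "localised N \<Phi> \<longleftrightarrow> q.saturated N \<and> trilinear_on fscale T (*) \<Phi> \<and>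
    (\<forall>p p' p'' u v. q.supports N (\<lambda>b. \<Phi> (tn p b) (tn p' u) (tn p'' v)) \<and>
      q.supports N (\<lambda>b. \<Phi> (tn p u) (tn p' b) (tn p'' v)) \<and>
      q.supports N (\<lambda>b. \<Phi> (tn p u) (tn p' v) (tn p'' b)))"

text \<open>The order of the quantifiers matters: one \<open>N\<close>, determined by the degrees
  alone, serves every \<open>\<Phi>\<close>, so a whole functional can be reduced to indices in
  \<open>N\<close>.\<close>

lemma ex_localised:
  obtains N where "q.saturated N" "\<And>\<Phi>. trilinear_on fscale T (*) \<Phi> \<Longrightarrow>
    localised N (\<lambda>u v w. \<Phi> (gr.component i u) (gr.component j v) (gr.component k w))"
proof -
  obtain N where N: "q.saturated N"
    "\<And>l h. l \<in> {i, j, k} \<Longrightarrow> h 0 = 0 \<Longrightarrow> q.supports N (\<lambda>u. h (b.component l u))"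
    by (rule q.ex_saturated[of "{i, j, k}"]) auto
  have "localised N (\<lambda>u v w. \<Phi> (gr.component i u) (gr.component j v) (gr.component k w))"
    if \<Phi>: "trilinear_on fscale T (*) \<Phi>" for \<Phi>
  proof -
    have "trilinear_on fscale T (*) (\<lambda>u v w. \<Phi> (gr.component i u) (gr.component j v) (gr.component k w))"
      using \<Phi> by (simp add: trilinear_on_def linear_on_def component_add component_scale component_in_T)
    moreover have "\<Phi> 0 v w = 0" "\<Phi> v 0 w = 0" "\<Phi> v w 0 = 0" if "v \<in> T" "w \<in> T" for v w
    proof -
      have s: "\<Phi> (fscale 0 v) v w = 0 * \<Phi> v v w" "\<Phi> v (fscale 0 v) w = 0 * \<Phi> v v w" "\<Phi> v w (fscale 0 v) = 0 * \<Phi> v w v"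
        using that \<Phi> unfolding trilinear_on_def linear_on_def by blast+
      then show "\<Phi> 0 v w = 0" "\<Phi> v 0 w = 0" "\<Phi> v w 0 = 0"
        by (simp_all only: fvs.scale_zero_left mult_zero_left)
    qed
    ultimately show ?thesis
      unfolding localised_def tensor_component
      using N(1) tn_in_T tensor_zero
      by (intro conjI allI N(2)[of i "\<lambda>b. \<Phi> (tn _ b) _ _"] N(2)[of j "\<lambda>b. \<Phi> _ (tn _ b) _"]
          N(2)[of k "\<lambda>b. \<Phi> _ _ (tn _ b)"]) simp_all
  qed
  then show ?thesis using that N(1) by blast
qed

text \<open>Freezing the factors from \<open>P\<close> leaves forms on \<open>B\<close>, subject to
  the Casimir identities; freezing those from \<open>B\<close> leaves a trilinear form on
  \<open>P\<close>, at which the PoiYBE can be evaluated.\<close>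

lemma localised_form:
  assumes "localised N \<Phi>"
  shows "\<And>v w. linear_on sB UNIV (*) (\<lambda>u. \<Phi> (tn p u) (tn p' v) (tn p'' w))"
    "\<And>u w. linear_on sB UNIV (*) (\<lambda>v. \<Phi> (tn p u) (tn p' v) (tn p'' w))"
    "\<And>u v. linear_on sB UNIV (*) (\<lambda>w. \<Phi> (tn p u) (tn p' v) (tn p'' w))"
    "\<And>v w. q.supports N (\<lambda>u. \<Phi> (tn p u) (tn p' v) (tn p'' w))"
    "\<And>u w. q.supports N (\<lambda>v. \<Phi> (tn p u) (tn p' v) (tn p'' w))"
    "\<And>u v. q.supports N (\<lambda>w. \<Phi> (tn p u) (tn p' v) (tn p'' w))"
    "trilinear_on sP UNIV (*) (\<lambda>p p' p''. \<Phi> (tn p u) (tn p' v) (tn p'' w))"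
  using assms tn_in_T tens_simps
  by (auto simp: localised_def trilinear_on_def linear_on_def)

section \<open>The two equations at a localised form\<close>

context
  fixes N \<Phi>
  assumes loc: "localised N \<Phi>"
begin

text \<open>This is \<open>M\<close>, and \<open>first_sum_flip\<close> is \<open>M'\<close>,
  evaluated with the factors from \<open>P\<close> left free: as trilinear forms on \<open>P\<close>
  they can be inserted into \<open>poiybe_form\<close>.\<close>

definition first_sum where
  "first_sum p p' p'' = (\<Sum>a\<in>N. \<Sum>b\<in>N. \<Phi> (tn p (circB (e a) (e b))) (tn p' (f a)) (tn p'' (f b)))"

definition first_sum_flip where
  "first_sum_flip p p' p'' = (\<Sum>a\<in>N. \<Sum>b\<in>N. \<Phi> (tn p (circB (e a) (e b))) (tn p' (f b)) (tn p'' (f a)))"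

lemma first_sum_trilinear:
  "trilinear_on sP UNIV (*) first_sum" "trilinear_on sP UNIV (*) first_sum_flip"
  using localised_form(7)[OF loc]
  by (simp_all add: first_sum_def first_sum_flip_def trilinear_on_def linear_on_def sum.distrib
      sum_distrib_left)

lemma saturated: "q.saturated N"
  using loc by (simp add: localised_def)

lemmas position = q.second_position[OF saturated localised_form(1-6)[OF loc]]
  q.third_position[OF saturated localised_form(1-6)[OF loc]]
  q.second_position_flip[OF saturated localised_form(1-6)[OF loc]]
  q.third_position_flip[OF saturated localised_form(1-6)[OF loc]]

lemmas position_sums = position[folded first_sum_def first_sum_flip_def]

text \<open>After the position identities only \<open>first_sum\<close> and
  \<open>first_sum_flip\<close> occur. Collected separately, they give \<open>A\<^sub>r\<close> at
  the first form minus \<open>A\<^sub>r\<close> at the second.\<close>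

lemma dpybe_circ_sum:
  assumes r: "finite I" "r = (\<Sum>i\<in>I. tens sP UNIV sP UNIV (x i) (y i))" "p.poiybe_solution r"
  shows "(\<Sum>a\<in>N. \<Sum>b\<in>N. \<Sum>i\<in>I. \<Sum>j\<in>I.
      \<Phi> (tn (x i) (e a)) (circ (tn (y i) (f a)) (tn (x j) (e b))) (tn (y j) (f b))
      - \<Phi> (tn (x i) (e a)) (tn (x j) (e b)) (circ (tn (y i) (f a)) (tn (y j) (f b)))
      + \<Phi> (circ (tn (x i) (e a)) (tn (x j) (e b))) (tn (y i) (f a)) (tn (y j) (f b))
      - \<Phi> (circ (tn (x i) (e a)) (tn (x j) (e b))) (tn (y j) (f b)) (tn (y i) (f a))) = 0" (is "?l = 0")
proof -
  \<comment> \<open>Only the last of the four terms has its arguments in another order; exchanging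
    \<open>i\<close> and \<open>j\<close> repairs this because \<open>mul\<close> is
    commutative.\<close>
  have flip: "(\<Sum>i\<in>I. \<Sum>j\<in>I. first_sum_flip (mul (x i) (x j)) (y j) (y i))
      = (\<Sum>i\<in>I. \<Sum>j\<in>I. first_sum_flip (mul (x i) (x j)) (y i) (y j))"
    by (subst sum.swap) (simp only: p.mul_commute)
  have "?l = (\<Sum>i\<in>I. \<Sum>j\<in>I.
      (first_sum_flip (x i) (mul (y i) (x j)) (y j) - first_sum (x i) (mul (y i) (x j)) (y j))
      - (first_sum_flip (x i) (x j) (mul (y i) (y j)) - first_sum (x i) (x j) (mul (y i) (y j)))
      + first_sum (mul (x i) (x j)) (y i) (y j) - first_sum_flip (mul (x i) (x j)) (y j) (y i))"
    unfolding circ_tens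
    by (subst sum_swap_pairs) (simp only: sum.distrib sum_subtractf position_sums
        first_sum_def[symmetric] first_sum_flip_def[symmetric])
  also have "\<dots> = (\<Sum>i\<in>I. \<Sum>j\<in>I. first_sum (mul (x i) (x j)) (y i) (y j)
        + first_sum (x i) (x j) (mul (y i) (y j)) - first_sum (x i) (mul (y i) (x j)) (y j))
      - (\<Sum>i\<in>I. \<Sum>j\<in>I. first_sum_flip (mul (x i) (x j)) (y i) (y j)
        + first_sum_flip (x i) (x j) (mul (y i) (y j)) - first_sum_flip (x i) (mul (y i) (x j)) (y j))"
    by (simp add: sum.distrib sum_subtractf flip)
  finally show ?thesis
    unfolding p.poiybe_form(1)[OF r first_sum_trilinear(1)] p.poiybe_form(1)[OF r first_sum_trilinear(2)]
    by simp
qed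

text \<open>The two contributions of \<open>first_sum_flip\<close> cancel by skew-symmetry of the
  bracket, and those of \<open>first_sum\<close> make up \<open>C\<^sub>r\<close>.\<close>

lemma dpybe_ast_sum:
  assumes r: "finite I" "r = (\<Sum>i\<in>I. tens sP UNIV sP UNIV (x i) (y i))" "p.poiybe_solution r"
  shows "(\<Sum>a\<in>N. \<Sum>b\<in>N. \<Sum>i\<in>I. \<Sum>j\<in>I.
      \<Phi> (ast (tn (x i) (e a)) (tn (x j) (e b))) (tn (y i) (f a)) (tn (y j) (f b))
      - \<Phi> (tn (x i) (e a)) (ast (tn (y i) (f a)) (tn (x j) (e b))) (tn (y j) (f b))
      - \<Phi> (tn (x j) (e b)) (ast (tn (x i) (e a)) (tn (y j) (f b))) (tn (y i) (f a))
      + \<Phi> (tn (x j) (e b)) (tn (x i) (e a)) (ast (tn (y i) (f a)) (tn (y j) (f b)))) = 0" (is "?l = 0")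
proof -
  have minus: "first_sum p (- p') p'' = - first_sum p p' p''" "first_sum p p' (- p'') = - first_sum p p' p''"
    "first_sum_flip p (- p') p'' = - first_sum_flip p p' p''" for p p' p''
  proof -
    have "first_sum p (sP c p') p'' = c * first_sum p p' p''"
      "first_sum p p' (sP c p'') = c * first_sum p p' p''"
      "first_sum_flip p (sP c p') p'' = c * first_sum_flip p p' p''" for c
      using first_sum_trilinear by (simp_all add: trilinear_on_def linear_on_def)
    from this[of "- 1"] show "first_sum p (- p') p'' = - first_sum p p' p''" "first_sum p p' (- p'') = - first_sum p p' p''"
      "first_sum_flip p (- p') p'' = - first_sum_flip p p' p''" by simp_all
  qed
  have skew: "first_sum_flip p (br (x j) (y i)) p'' = - first_sum_flip p (br (y i) (x j)) p''"
    "first_sum (x i) (x j) (br (y j) (y i)) = - first_sum (x i) (x j) (br (y i) (y j))" for p p'' i j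
    by (simp_all only: br_skew[of "x j" "y i"] br_skew[of "y j" "y i"] minus)
  \<comment> \<open>Exchanging \<open>i\<close> and \<open>j\<close> reverses the bracket. The first
    identity produces the cancellation, the second absorbs the sign from
    \<open>third_position_flip\<close>.\<close>
  have flip: "(\<Sum>i\<in>I. \<Sum>j\<in>I. first_sum_flip (x j) (br (x i) (y j)) (y i))
      = - (\<Sum>i\<in>I. \<Sum>j\<in>I. first_sum_flip (x i) (br (y i) (x j)) (y j))"
    "(\<Sum>i\<in>I. \<Sum>j\<in>I. first_sum (x j) (x i) (br (y i) (y j)))
      = - (\<Sum>i\<in>I. \<Sum>j\<in>I. first_sum (x i) (x j) (br (y i) (y j)))"
    by (subst sum.swap, simp only: skew sum_negf)+
  have "?l = (\<Sum>i\<in>I. \<Sum>j\<in>I. first_sum (br (x i) (x j)) (y i) (y j)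
      - (first_sum_flip (x i) (br (y i) (x j)) (y j) - first_sum (x i) (br (y i) (x j)) (y j))
      - first_sum_flip (x j) (br (x i) (y j)) (y i)
      + - first_sum (x j) (x i) (br (y i) (y j)))"
    unfolding ast_tens
    by (subst sum_swap_pairs) (simp only: sum.distrib sum_subtractf position_sums
        first_sum_def[symmetric] first_sum_flip_def[symmetric])
  also have "\<dots> = (\<Sum>i\<in>I. \<Sum>j\<in>I. first_sum (br (x i) (x j)) (y i) (y j)
        + first_sum (x i) (x j) (br (y i) (y j)) + first_sum (x i) (br (y i) (x j)) (y j))"
    by (simp add: sum.distrib sum_subtractf sum_negf flip)
  finally show ?thesis
    unfolding p.poiybe_form(2)[OF r first_sum_trilinear(1)] .
qed

lemma localised_outside:
  assumes "a \<in> \<Omega> - N"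
  shows "\<Phi> (tn p (e a)) (tn p' u) (tn p'' v) = 0" "\<Phi> (tn p (f a)) (tn p' u) (tn p'' v) = 0"
    "\<Phi> (tn p u) (tn p' (e a)) (tn p'' v) = 0" "\<Phi> (tn p u) (tn p' (f a)) (tn p'' v) = 0"
    "\<Phi> (tn p u) (tn p' v) (tn p'' (e a)) = 0" "\<Phi> (tn p u) (tn p' v) (tn p'' (f a)) = 0"
  using localised_form(4-6)[OF loc] assms by (auto simp: q.supports_def)

end

section \<open>Passage to the completed tensor cube\<close>

lemma induced_r_eq:
  "induced_r sP sB G I x y \<Omega> e f k l = (\<Sum>(c, i)\<in>{c\<in>\<Omega>. q.index_degree c = (k, l)} \<times> I.
    tt (tn (x i) (e c)) (tn (y i) (f c)))"
  unfolding induced_r_def q.index_set sum.cartesian_product[symmetric] by (rule sum.swap)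

lemma induced_r_in_completed_tensor: "induced_r sP sB G I x y \<Omega> e f \<in> gr.completed_tensor"
  unfolding gr.completed_tensor_def induced_r_def total_eq_T
proof (rule CollectI, intro allI fvs.span_sum fvs.span_base)
  fix k l i c assume "c \<in> {j \<in> \<Omega>. e j \<in> G k \<and> f j \<in> G l}"
  then have "tn (x i) (e c) \<in> A k" "tn (y i) (f c) \<in> A l"
    unfolding induced_grading_def by (auto intro: fvs.span_base)
  then show "tt (tn (x i) (e c)) (tn (y i) (f c)) \<in> {tt u v | u v. u \<in> A k \<and> v \<in> A l}" by blast
qed

text \<open>In a fixed degree, the contributions of the pairs of components of the induced element
  are sums over the fibres of the bidegree map on \<open>\<Omega> \<times> \<Omega>\<close>. Pairs
  outside \<open>N \<times> N\<close> contribute nothing, so \<open>Sum_any_fibres\<close> leaves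
  the finite sum in \<open>zero\<close>.\<close>

lemma completed_sum_vanishesI:
  fixes F :: "('k, 'p, 'b) tensor \<Rightarrow> ('k, 'p, 'b) tensor \<Rightarrow> ('k, 'p, 'b) tensor \<Rightarrow> ('k, 'p, 'b) tensor
      \<Rightarrow> ('k, ('k, 'p, 'b) tensor) tensor3"
  assumes I: "finite I" and F: "quadrilinear_on fscale T fscale T F"
    and outside: "\<And>N \<Phi> a b i j. localised N \<Phi> \<Longrightarrow> a \<in> \<Omega> \<Longrightarrow> b \<in> \<Omega> \<Longrightarrow> a \<notin> N \<or> b \<notin> N \<Longrightarrow>
      F (tn (x i) (e a)) (tn (y i) (f a)) (tn (x j) (e b)) (tn (y j) (f b)) \<Phi> = 0"
    and zero: "\<And>N \<Phi>. localised N \<Phi> \<Longrightarrow> (\<Sum>a\<in>N. \<Sum>b\<in>N. \<Sum>i\<in>I. \<Sum>j\<in>I.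
      F (tn (x i) (e a)) (tn (y i) (f a)) (tn (x j) (e b)) (tn (y j) (f b)) \<Phi>) = 0"
  shows "gr.completed_sum_vanishes F (induced_r sP sB G I x y \<Omega> e f)"
  unfolding gr.completed_sum_vanishes_def Let_def total_eq_T
proof (intro allI)
  fix k1 k2 k3
  let ?s = "induced_r sP sB G I x y \<Omega> e f"
  let ?J = "\<lambda>k l. {c\<in>\<Omega>. q.index_degree c = (k, l)}"
  obtain N where sat: "q.saturated N" and N: "\<And>\<Phi>. trilinear_on fscale T (*) \<Phi> \<Longrightarrow>
    localised N (\<lambda>u v w. \<Phi> (gr.component k1 u) (gr.component k2 v) (gr.component k3 w))"
    using ex_localised[of k1 k2 k3] by blast
  let ?proj = "\<lambda>\<Phi> u v w. \<Phi> (gr.component k1 u) (gr.component k2 v) (gr.component k3 w)"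
  define D where "D = (\<lambda>(a, b). (fst (q.index_degree a), snd (q.index_degree a),
    fst (q.index_degree b), snd (q.index_degree b)))"
  \<comment> \<open>The contribution of one pair of indices, as a functional; the default value 0
    matches that of \<open>tensor3_map\<close> on functions that are not trilinear.\<close>
  define \<tau> where "\<tau> = (\<lambda>(a, b) \<Phi>. if trilinear_on fscale T (*) \<Phi> then \<Sum>i\<in>I. \<Sum>j\<in>I.
    F (tn (x i) (e a)) (tn (y i) (f a)) (tn (x j) (e b)) (tn (y j) (f b)) (?proj \<Phi>) else 0)"
  let ?t = "\<lambda>(p, q, p', q'). tensor3_map fscale T (gr.component k1) (gr.component k2) (gr.component k3)
    (tensor_lift2 F (?s p q) (?s p' q'))"
  have fibre: "{w \<in> \<Omega> \<times> \<Omega>. D w = (p, q, p', q')} = ?J p q \<times> ?J p' q'" for p q p' q'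
    by (auto simp: D_def prod_eq_iff)
  have lift: "tensor_lift2 F (?s p q) (?s p' q') = (\<Sum>(a, i)\<in>?J p q \<times> I. \<Sum>(b, j)\<in>?J p' q' \<times> I.
      F (tn (x i) (e a)) (tn (y i) (f a)) (tn (x j) (e b)) (tn (y j) (f b)))" for p q p' q'
    unfolding induced_r_eq case_prod_beta
    by (rule TT.tensor_lift2_sum[OF F]) (simp_all add: q.finite_index_set I tn_in_T)
  have t: "?t d = (\<Sum>w | w \<in> \<Omega> \<times> \<Omega> \<and> D w = d. \<tau> w)" for d
  proof -
    obtain p q p' q' where d: "d = (p, q, p', q')" by (metis surj_pair)
    have "?t d \<Phi> = (\<Sum>w\<in>?J p q \<times> ?J p' q'. \<tau> w \<Phi>)" for \<Phi>
    proof (cases "trilinear_on fscale T (*) \<Phi>")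
      case True
      have "?t d \<Phi> = (\<Sum>a\<in>?J p q. \<Sum>i\<in>I. \<Sum>b\<in>?J p' q'. \<Sum>j\<in>I.
        F (tn (x i) (e a)) (tn (y i) (f a)) (tn (x j) (e b)) (tn (y j) (f b)) (?proj \<Phi>))"
        by (simp add: d lift tensor3_map_def True sum_fun_apply case_prod_beta sum.cartesian_product')
      also have "\<dots> = (\<Sum>a\<in>?J p q. \<Sum>b\<in>?J p' q'. \<Sum>i\<in>I. \<Sum>j\<in>I.
        F (tn (x i) (e a)) (tn (y i) (f a)) (tn (x j) (e b)) (tn (y j) (f b)) (?proj \<Phi>))"
        by (rule sum.cong[OF refl], rule sum.swap)
      also have "\<dots> = (\<Sum>w\<in>?J p q \<times> ?J p' q'. \<tau> w \<Phi>)"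
        by (simp add: \<tau>_def True case_prod_beta sum.cartesian_product')
      finally show ?thesis .
    qed (simp add: d tensor3_map_def \<tau>_def case_prod_beta)
    then show ?thesis
      unfolding d fibre by (intro ext) (simp add: sum_fun_apply)
  qed
  have fin: "finite {w \<in> \<Omega> \<times> \<Omega>. D w = d}" for d
    by (cases d) (simp add: fibre q.finite_index_set)
  have out: "\<tau> w = 0" if "w \<in> \<Omega> \<times> \<Omega> - N \<times> N" for w
  proof -
    obtain a b where w: "w = (a, b)" by (cases w)
    then have ab: "a \<in> \<Omega>" "b \<in> \<Omega>" "a \<notin> N \<or> b \<notin> N"
      using that by auto
    show ?thesis
      unfolding w \<tau>_def by (auto simp: fun_eq_iff outside[OF N ab])
  qed
  have "finite (N \<times> N)" "N \<times> N \<subseteq> \<Omega> \<times> \<Omega>" using q.saturatedD(1,2)[OF sat] by auto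
  note fibres = Sum_any_fibres[OF this out fin t]
  have "sum \<tau> (N \<times> N) = 0"
  proof
    fix \<Phi>
    show "sum \<tau> (N \<times> N) \<Phi> = 0 \<Phi>"
      using zero[OF N, of \<Phi>]
      by (cases "trilinear_on fscale T (*) \<Phi>")
        (simp_all add: sum_fun_apply \<tau>_def case_prod_beta sum.cartesian_product')
  qed
  then show "finite {d. ?t d \<noteq> 0} \<and> Sum_any ?t = 0"
    using fibres by simp
qed

theorem induced_r_solution:
  assumes r: "finite I" "r = (\<Sum>i\<in>I. tens sP UNIV sP UNIV (x i) (y i))" "p.poiybe_solution r"
  shows "dpp.completed_dpybe_solution (induced_r sP sB G I x y \<Omega> e f)"
  unfolding dpp.completed_dpybe_solution_def
proof (intro conjI induced_r_in_completed_tensor)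
  have closed: "\<And>u v. u \<in> T \<Longrightarrow> v \<in> T \<Longrightarrow> circ u v \<in> T" "\<And>u v. u \<in> T \<Longrightarrow> v \<in> T \<Longrightarrow> ast u v \<in> T"
    by (rule product_simps; assumption)+
  note quad = quadrilinear_tens3[OF TT.vs(1,2) dpp.circ_bilinear[unfolded total_eq_T] closed(1)]
    quadrilinear_tens3[OF TT.vs(1,2) dpp.ast_bilinear[unfolded total_eq_T] closed(2)]
  have circ_quad: "quadrilinear_on fscale T fscale T (\<lambda>x y x' y'. tens3 fscale T x (circ y x') y' - tens3 fscale T x x' (circ y y')
      + tens3 fscale T (circ x x') y y' - tens3 fscale T (circ x x') y' y)"
    by (intro quadrilinear_add quad)
  have ast_quad: "quadrilinear_on fscale T fscale T (\<lambda>x y x' y'. tens3 fscale T (ast x x') y y' - tens3 fscale T x (ast y x') y'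
      - tens3 fscale T x' (ast x y') y + tens3 fscale T x' x (ast y y'))"
    by (intro quadrilinear_add quad)
  have tri: "trilinear_on fscale T (*) \<Phi>" if "localised N \<Phi>" for N \<Phi>
    using that by (simp add: localised_def)
  show "gr.completed_sum_vanishes (\<lambda>x y x' y'. dpp.atens3 x (circ y x') y' - dpp.atens3 x x' (circ y y')
      + dpp.atens3 (circ x x') y y' - dpp.atens3 (circ x x') y' y) (induced_r sP sB G I x y \<Omega> e f)"
    unfolding total_eq_T
  proof (rule completed_sum_vanishesI[OF r(1) circ_quad])
    fix N \<Phi> assume loc: "localised N \<Phi>"
    show "(\<Sum>a\<in>N. \<Sum>b\<in>N. \<Sum>i\<in>I. \<Sum>j\<in>I.
      (tens3 fscale T (tn (x i) (e a)) (circ (tn (y i) (f a)) (tn (x j) (e b))) (tn (y j) (f b))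
      - tens3 fscale T (tn (x i) (e a)) (tn (x j) (e b)) (circ (tn (y i) (f a)) (tn (y j) (f b)))
      + tens3 fscale T (circ (tn (x i) (e a)) (tn (x j) (e b))) (tn (y i) (f a)) (tn (y j) (f b))
      - tens3 fscale T (circ (tn (x i) (e a)) (tn (x j) (e b))) (tn (y j) (f b)) (tn (y i) (f a))) \<Phi>) = 0"
      using dpybe_circ_sum[OF loc r] by (simp add: tens3_def tri[OF loc])
  \<comment> \<open>The remaining goal is the vanishing outside \<open>N\<close>. Each term
    multiplies one leg of index \<open>a\<close> with one of index \<open>b\<close>, so both indices
    also occur in an unmultiplied leg, where \<open>\<Phi>\<close> is localised. The same holds for
    the second equation.\<close>
  qed (auto simp: tens3_def tri circ_tens localised_outside)
  show "gr.completed_sum_vanishes (\<lambda>x y x' y'. dpp.atens3 (ast x x') y y' - dpp.atens3 x (ast y x') y'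
      - dpp.atens3 x' (ast x y') y + dpp.atens3 x' x (ast y y')) (induced_r sP sB G I x y \<Omega> e f)"
    unfolding total_eq_T
  proof (rule completed_sum_vanishesI[OF r(1) ast_quad])
    fix N \<Phi> assume loc: "localised N \<Phi>"
    show "(\<Sum>a\<in>N. \<Sum>b\<in>N. \<Sum>i\<in>I. \<Sum>j\<in>I.
      (tens3 fscale T (ast (tn (x i) (e a)) (tn (x j) (e b))) (tn (y i) (f a)) (tn (y j) (f b))
      - tens3 fscale T (tn (x i) (e a)) (ast (tn (y i) (f a)) (tn (x j) (e b))) (tn (y j) (f b))
      - tens3 fscale T (tn (x j) (e b)) (ast (tn (x i) (e a)) (tn (y j) (f b))) (tn (y i) (f a))
      + tens3 fscale T (tn (x j) (e b)) (tn (x i) (e a)) (ast (tn (y i) (f a)) (tn (y j) (f b)))) \<Phi>) = 0"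
      using dpybe_ast_sum[OF loc r] by (simp add: tens3_def tri[OF loc])
  qed (auto simp: tens3_def tri ast_tens localised_outside)
qed

end


section \<open>Flip and invariance\<close>

context induced_r_setting
begin

text \<open>The other argument ranges over all of \<open>T\<close>, since it may be the image of a
  pure tensor under a map that does not preserve pure tensors.\<close>

definition bilocalised :: "'j set \<Rightarrow> (('k, 'p, 'b) tensor \<Rightarrow> ('k, 'p, 'b) tensor \<Rightarrow> 'k) \<Rightarrow> bool"
  where "bilocalised N \<phi> \<longleftrightarrow> q.saturated N \<and> bilinear_on fscale T fscale T (*) \<phi> \<and>
    (\<forall>p. \<forall>v\<in>T. q.supports N (\<lambda>b. \<phi> (tn p b) v) \<and> q.supports N (\<lambda>b. \<phi> v (tn p b)))"

lemma bilinear_zero: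
  assumes "bilinear_on fscale T fscale T (*) \<phi>" "v \<in> T"
  shows "\<phi> 0 v = 0" "\<phi> v 0 = 0"
proof -
  have "\<phi> (fscale 0 v) v = 0 * \<phi> v v" "\<phi> v (fscale 0 v) = 0 * \<phi> v v"
    using assms unfolding bilinear_on_def linear_on_def by blast+
  then show "\<phi> 0 v = 0" "\<phi> v 0 = 0"
    by (simp_all only: fvs.scale_zero_left mult_zero_left)
qed

lemma ex_bilocalised:
  obtains N where "q.saturated N" "\<And>\<phi>. bilinear_on fscale T fscale T (*) \<phi> \<Longrightarrow>
    bilocalised N (\<lambda>u v. \<phi> (gr.component i u) (gr.component j v))"
proof -
  obtain N where N: "q.saturated N"
    "\<And>l h. l \<in> {i, j} \<Longrightarrow> h 0 = 0 \<Longrightarrow> q.supports N (\<lambda>u. h (b.component l u))"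
    by (rule q.ex_saturated[of "{i, j}"]) auto
  have "bilocalised N (\<lambda>u v. \<phi> (gr.component i u) (gr.component j v))"
    if \<phi>: "bilinear_on fscale T fscale T (*) \<phi>" for \<phi>
  proof -
    have "bilinear_on fscale T fscale T (*) (\<lambda>u v. \<phi> (gr.component i u) (gr.component j v))"
      using \<phi> by (simp add: bilinear_on_def linear_on_def component_add component_scale component_in_T)
    then show ?thesis
      unfolding bilocalised_def tensor_component
      using N(1) tensor_zero bilinear_zero[OF \<phi>] component_in_T
      by (intro conjI allI ballI N(2)[of i "\<lambda>b. \<phi> (tn _ b) _"] N(2)[of j "\<lambda>b. \<phi> _ (tn _ b)"]) simp_all
  qed
  then show ?thesis using that N(1) by blast
qed

lemma bilocalised_form:
  assumes "bilocalised N \<phi>"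
  shows "\<And>v. linear_on sB UNIV (*) (\<lambda>u. \<phi> (tn p u) (tn p' v))"
    "\<And>u. linear_on sB UNIV (*) (\<lambda>v. \<phi> (tn p u) (tn p' v))"
    "\<And>v. q.supports N (\<lambda>u. \<phi> (tn p u) (tn p' v))"
    "\<And>u. q.supports N (\<lambda>v. \<phi> (tn p u) (tn p' v))"
    "bilinear_on sP UNIV sP UNIV (*) (\<lambda>p p'. \<phi> (tn p u) (tn p' v))"
  using assms tn_in_T tens_simps
  by (auto simp: bilocalised_def bilinear_on_def linear_on_def)

lemma bilocalised_casimir:
  assumes loc: "bilocalised N \<phi>"
  shows "(\<Sum>c\<in>N. \<phi> (tn p (e c)) (tn p' (f c))) = - (\<Sum>c\<in>N. \<phi> (tn p (f c)) (tn p' (e c)))"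
    "(\<Sum>c\<in>N. \<phi> (tn p (e c)) (tn p' (circB (f c) u)))
      = (\<Sum>c\<in>N. \<phi> (tn p (circB u (e c) - circB (e c) u)) (tn p' (f c)))"
proof -
  have N: "q.saturated N" using loc by (simp add: bilocalised_def)
  show "(\<Sum>c\<in>N. \<phi> (tn p (e c)) (tn p' (f c))) = - (\<Sum>c\<in>N. \<phi> (tn p (f c)) (tn p' (e c)))"
    by (rule q.casimir_skew[OF N bilocalised_form(1-3)[OF loc]])
  show "(\<Sum>c\<in>N. \<phi> (tn p (e c)) (tn p' (circB (f c) u)))
      = (\<Sum>c\<in>N. \<phi> (tn p (circB u (e c) - circB (e c) u)) (tn p' (f c)))"
    by (rule q.casimir_invariant[OF N bilocalised_form(1-4)[OF loc]])
qed

lemma induced_r_apply: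
  "induced_r sP sB G I x y \<Omega> e f k l \<phi> = (if bilinear_on fscale T fscale T (*) \<phi>
    then \<Sum>c | c \<in> \<Omega> \<and> q.index_degree c = (k, l). \<Sum>i\<in>I. \<phi> (tn (x i) (e c)) (tn (y i) (f c)) else 0)"
  unfolding induced_r_eq
  by (simp add: sum_fun_apply case_prod_beta tens_def[of fscale T fscale T] sum.cartesian_product')

text \<open>The projections fix the basis vectors of the selected bidegree and kill all terms of
  other bidegrees, while indices outside \<open>N\<close> vanish by localisation; both sums are
  compared with the one over the union. In the second claim \<open>e\<close> and \<open>f\<close>
  trade places, hence the bidegree \<open>(l, k)\<close>.\<close>

lemma sum_over_degree:
  assumes \<phi>: "bilinear_on fscale T fscale T (*) \<phi>"
    and N: "finite N" "N \<subseteq> \<Omega>"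
    and loc: "bilocalised N (\<lambda>u v. \<phi> (gr.component k u) (gr.component l v))"
  shows "(\<Sum>c | c \<in> \<Omega> \<and> q.index_degree c = (k, l). \<phi> (tn p (e c)) (tn p' (f c)))
      = (\<Sum>c\<in>N. \<phi> (gr.component k (tn p (e c))) (gr.component l (tn p' (f c))))"
    "(\<Sum>c | c \<in> \<Omega> \<and> q.index_degree c = (l, k). \<phi> (tn p (f c)) (tn p' (e c)))
      = (\<Sum>c\<in>N. \<phi> (gr.component k (tn p (f c))) (gr.component l (tn p' (e c))))"
proof -
  let ?\<phi> = "\<lambda>u v. \<phi> (gr.component k u) (gr.component l v)"
  have e: "b.component i (e c) = (if i = fst (q.index_degree c) then e c else 0)"
    and f: "b.component i (f c) = (if i = snd (q.index_degree c) then f c else 0)" if "c \<in> \<Omega>" for i c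
    using q.in_degree_iff[OF that] by (simp_all add: b.component_homogeneous)
  have out: "?\<phi> (tn p (e c)) v = 0" "?\<phi> (tn p (f c)) v = 0" if "c \<in> \<Omega> - N" "v \<in> T" for c v p
    using loc that by (auto simp: bilocalised_def q.supports_def)
  have J: "finite {c \<in> \<Omega>. q.index_degree c = d}" for d by (rule q.finite_index_set)
  note zero = bilinear_zero[OF \<phi>] tensor_zero tn_in_T
  have "(\<Sum>c | c \<in> \<Omega> \<and> q.index_degree c = (k, l). \<phi> (tn p (e c)) (tn p' (f c)))
      = (\<Sum>c | c \<in> \<Omega> \<and> q.index_degree c = (k, l). ?\<phi> (tn p (e c)) (tn p' (f c)))"
    by (intro sum.cong) (auto simp: tensor_component e f)
  also have "\<dots> = (\<Sum>c\<in>{c \<in> \<Omega>. q.index_degree c = (k, l)} \<union> N. ?\<phi> (tn p (e c)) (tn p' (f c)))"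
    using N J by (intro sum.mono_neutral_left) (auto simp: tensor_component e f zero prod_eq_iff subsetD[OF N(2)]
        split: if_splits)
  also have "\<dots> = (\<Sum>c\<in>N. ?\<phi> (tn p (e c)) (tn p' (f c)))"
    using N J out tn_in_T by (intro sum.mono_neutral_right) auto
  finally show "(\<Sum>c | c \<in> \<Omega> \<and> q.index_degree c = (k, l). \<phi> (tn p (e c)) (tn p' (f c)))
      = (\<Sum>c\<in>N. ?\<phi> (tn p (e c)) (tn p' (f c)))" .
  have "(\<Sum>c | c \<in> \<Omega> \<and> q.index_degree c = (l, k). \<phi> (tn p (f c)) (tn p' (e c)))
      = (\<Sum>c | c \<in> \<Omega> \<and> q.index_degree c = (l, k). ?\<phi> (tn p (f c)) (tn p' (e c)))"
    by (intro sum.cong) (auto simp: tensor_component e f)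
  also have "\<dots> = (\<Sum>c\<in>{c \<in> \<Omega>. q.index_degree c = (l, k)} \<union> N. ?\<phi> (tn p (f c)) (tn p' (e c)))"
    using N J by (intro sum.mono_neutral_left) (auto simp: tensor_component e f zero prod_eq_iff subsetD[OF N(2)]
        split: if_splits)
  also have "\<dots> = (\<Sum>c\<in>N. ?\<phi> (tn p (f c)) (tn p' (e c)))"
    using N J out tn_in_T by (intro sum.mono_neutral_right) auto
  finally show "(\<Sum>c | c \<in> \<Omega> \<and> q.index_degree c = (l, k). \<phi> (tn p (f c)) (tn p' (e c)))
      = (\<Sum>c\<in>N. ?\<phi> (tn p (f c)) (tn p' (e c)))" .
qed

text \<open>The skew-symmetry of the form turns into a sign when the two dual bases are exchanged.\<close>

lemma completed_flip_induced_r: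
  "completed_flip (induced_r sP sB G I x y \<Omega> e f) = - induced_r sP sB G I y x \<Omega> e f"
proof (intro ext)
  fix k l and \<phi> :: "('k, 'p, 'b) tensor \<Rightarrow> ('k, 'p, 'b) tensor \<Rightarrow> 'k"
  show "completed_flip (induced_r sP sB G I x y \<Omega> e f) k l \<phi> = (- induced_r sP sB G I y x \<Omega> e f) k l \<phi>"
  proof (cases "bilinear_on fscale T fscale T (*) \<phi>")
    case True
    obtain N where sat: "q.saturated N"
      and N: "bilocalised N (\<lambda>u v. \<phi> (gr.component k u) (gr.component l v))"
      using ex_bilocalised[of k l] True by blast
    have flip: "bilinear_on fscale T fscale T (*) (\<lambda>u v. \<phi> v u)"
      using True by (auto simp: bilinear_on_def)
    have sums: "(\<Sum>c | c \<in> \<Omega> \<and> q.index_degree c = (l, k). \<phi> (tn p (f c)) (tn p' (e c)))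
        = - (\<Sum>c | c \<in> \<Omega> \<and> q.index_degree c = (k, l). \<phi> (tn p (e c)) (tn p' (f c)))" for p p'
      unfolding sum_over_degree[OF True q.saturatedD(1,2)[OF sat] N] bilocalised_casimir(1)[OF N] by simp
    have "completed_flip (induced_r sP sB G I x y \<Omega> e f) k l \<phi>
        = (\<Sum>i\<in>I. \<Sum>c | c \<in> \<Omega> \<and> q.index_degree c = (l, k). \<phi> (tn (y i) (f c)) (tn (x i) (e c)))"
      using flip by (simp add: completed_flip_def tensor_flip_def induced_r_apply sum.swap[of _ _ I])
    also have "\<dots> = - induced_r sP sB G I y x \<Omega> e f k l \<phi>"
      unfolding sums using True by (simp add: induced_r_apply sum_negf sum.swap[of _ _ I])
    finally show ?thesis by simp
  next
    case False
    then have "\<not> bilinear_on fscale T fscale T (*) (\<lambda>u v. \<phi> v u)"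
      by (auto simp: bilinear_on_def)
    with False show ?thesis
      by (simp add: completed_flip_def tensor_flip_def induced_r_apply)
  qed
qed

lemma tensor_sum_apply:
  assumes "r = (\<Sum>i\<in>I. tens sP UNIV sP UNIV (x i) (y i))" "bilinear_on sP UNIV sP UNIV (*) \<phi>"
  shows "r \<phi> = (\<Sum>i\<in>I. \<phi> (x i) (y i))"
  using assms by (simp add: sum_fun_apply tens_def)

text \<open>Two signs cancel: one from \<open>completed_flip_induced_r\<close>, the other from
  skew-symmetry of \<open>r\<close>, tested at the forms on \<open>P\<close> obtained by freezing
  the factors from \<open>B\<close>.\<close>

theorem induced_r_symmetric:
  assumes r: "r = (\<Sum>i\<in>I. tens sP UNIV sP UNIV (x i) (y i))" and skew: "tensor_flip r = - r"
  shows "completed_flip (induced_r sP sB G I x y \<Omega> e f) = induced_r sP sB G I x y \<Omega> e f"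
proof -
  have flip: "(\<Sum>i\<in>I. \<phi> (y i) (x i)) = - (\<Sum>i\<in>I. \<phi> (x i) (y i))"
    if \<phi>: "bilinear_on sP UNIV sP UNIV (*) \<phi>" for \<phi>
  proof -
    have \<phi>': "bilinear_on sP UNIV sP UNIV (*) (\<lambda>p q. \<phi> q p)"
      using \<phi> by (auto simp: bilinear_on_def)
    have "r (\<lambda>p q. \<phi> q p) = - r \<phi>"
      using fun_cong[OF skew, of \<phi>] by (simp add: tensor_flip_def)
    then show ?thesis
      unfolding tensor_sum_apply[OF r \<phi>] tensor_sum_apply[OF r \<phi>'] .
  qed
  have "(- induced_r sP sB G I y x \<Omega> e f) k l \<phi> = induced_r sP sB G I x y \<Omega> e f k l \<phi>" for k l \<phi>
  proof (cases "bilinear_on fscale T fscale T (*) \<phi>")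
    case True
    then have "bilinear_on sP UNIV sP UNIV (*) (\<lambda>p p'. \<phi> (tn p u) (tn p' v))" for u v
      using tn_in_T tens_simps by (auto simp: bilinear_on_def linear_on_def)
    from flip[OF this] show ?thesis
      by (simp add: induced_r_apply sum_negf)
  qed (simp add: induced_r_apply)
  then show ?thesis unfolding completed_flip_induced_r by blast
qed

text \<open>\<open>F\<close> and \<open>H\<close> may shift degrees, so components of all bidegrees
  can contribute. The one that is \<open>id\<close> leaves a basis vector in its leg, and the
  projection to a fixed degree then restricts the sum to \<open>N\<close>.\<close>

lemma completed_map_induced_r:
  assumes I: "finite I"
    and F: "linear_on fscale T fscale F" "F ` T \<subseteq> T" and H: "linear_on fscale T fscale H" "H ` T \<subseteq> T"
    and N: "q.saturated N" "\<And>\<phi>. bilinear_on fscale T fscale T (*) \<phi> \<Longrightarrow>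
      bilocalised N (\<lambda>u v. \<phi> (gr.component k u) (gr.component l v))"
    and id: "F = id \<or> H = id"
  shows "gr.completed_map F H (induced_r sP sB G I x y \<Omega> e f) k l \<phi> = (if bilinear_on fscale T fscale T (*) \<phi>
    then \<Sum>c\<in>N. \<Sum>i\<in>I. \<phi> (gr.component k (F (tn (x i) (e c)))) (gr.component l (H (tn (y i) (f c))))
    else 0)"
proof -
  define \<tau> where "\<tau> = (\<lambda>c \<phi>. if bilinear_on fscale T fscale T (*) \<phi>
    then \<Sum>i\<in>I. \<phi> (gr.component k (F (tn (x i) (e c)))) (gr.component l (H (tn (y i) (f c)))) else 0)"
  let ?t = "\<lambda>(p, q). tensor_map fscale T fscale T (gr.component k \<circ> F) (gr.component l \<circ> H)
    (induced_r sP sB G I x y \<Omega> e f p q)"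
  have pull: "bilinear_on fscale T fscale T (*) (\<lambda>u v. \<phi> ((gr.component k \<circ> F) u) ((gr.component l \<circ> H) v))"
    if "bilinear_on fscale T fscale T (*) \<phi>" for \<phi>
    using that F H
    by (simp add: bilinear_on_def linear_on_def image_subset_iff component_add component_scale component_in_T)
  have "?t d \<phi> = (\<Sum>c | c \<in> \<Omega> \<and> q.index_degree c = d. \<tau> c) \<phi>" for d \<phi>
    using pull[of \<phi>]
    by (cases d) (simp add: sum_fun_apply \<tau>_def tensor_map_def induced_r_apply)
  then have t: "?t d = (\<Sum>c | c \<in> \<Omega> \<and> q.index_degree c = d. \<tau> c)" for d by blast
  have out: "\<tau> c = 0" if c: "c \<in> \<Omega> - N" for c
  proof -
    have zero: "\<phi> (gr.component k (F (tn p (e c)))) (gr.component l (H (tn p' (f c)))) = 0"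
      if \<phi>: "bilinear_on fscale T fscale T (*) \<phi>" for p p' \<phi>
    proof -
      have T: "F (tn p (e c)) \<in> T" "H (tn p' (f c)) \<in> T" using F(2) H(2) tn_in_T by auto
      have "\<phi> (gr.component k (tn p (e c))) (gr.component l v) = 0"
        "\<phi> (gr.component k v) (gr.component l (tn p' (f c))) = 0" if "v \<in> T" for v
        using N(2)[OF \<phi>] that c by (auto simp: bilocalised_def q.supports_def)
      then show ?thesis using id T by auto
    qed
    then show ?thesis by (auto simp: \<tau>_def fun_eq_iff zero intro!: sum.neutral)
  qed
  have "Sum_any ?t = sum \<tau> N"
    by (rule Sum_any_fibres(2)[OF q.saturatedD(1,2)[OF N(1)] out q.finite_index_set t])
  then show ?thesis
    unfolding gr.completed_map_def total_eq_T by (simp add: sum_fun_apply \<tau>_def)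
qed

section \<open>From Poi-invariance to DP-invariance\<close>

lemma poi_invariant_form:
  assumes r: "r = (\<Sum>i\<in>I. tens sP UNIV sP UNIV (x i) (y i))" and inv: "p.poi_invariant r"
    and \<phi>: "bilinear_on sP UNIV sP UNIV (*) \<phi>"
  shows "(\<Sum>i\<in>I. \<phi> (x i) (mul p (y i))) = (\<Sum>i\<in>I. \<phi> (mul p (x i)) (y i))"
    "(\<Sum>i\<in>I. \<phi> (x i) (br p (y i))) = - (\<Sum>i\<in>I. \<phi> (br p (x i)) (y i))"
proof -
  have pull: "bilinear_on sP UNIV sP UNIV (*) (\<lambda>u v. \<phi> (id u) (mul p v))"
    "bilinear_on sP UNIV sP UNIV (*) (\<lambda>u v. \<phi> (mul p u) (id v))"
    "bilinear_on sP UNIV sP UNIV (*) (\<lambda>u v. \<phi> (id u) (br p v))"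
    "bilinear_on sP UNIV sP UNIV (*) (\<lambda>u v. \<phi> (br p u) (id v))"
    using \<phi> p.mul_bilinear p.br_bilinear by (simp_all add: bilinear_on_def linear_on_def)
  have "(p.pmap id (mul p) r - p.pmap (mul p) id r) \<phi> = 0" "(p.pmap id (br p) r + p.pmap (br p) id r) \<phi> = 0"
    using inv by (simp_all add: p.poi_invariant_def)
  then have "r (\<lambda>u v. \<phi> (id u) (mul p v)) - r (\<lambda>u v. \<phi> (mul p u) (id v)) = 0"
    "r (\<lambda>u v. \<phi> (id u) (br p v)) + r (\<lambda>u v. \<phi> (br p u) (id v)) = 0"
    using \<phi> by (simp_all add: tensor_map_def)
  then show "(\<Sum>i\<in>I. \<phi> (x i) (mul p (y i))) = (\<Sum>i\<in>I. \<phi> (mul p (x i)) (y i))"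
    "(\<Sum>i\<in>I. \<phi> (x i) (br p (y i))) = - (\<Sum>i\<in>I. \<phi> (br p (x i)) (y i))"
    unfolding pull[THEN tensor_sum_apply[OF r]] by (simp_all add: eq_neg_iff_add_eq_0)
qed

context
  fixes N \<phi> and I :: "'i set" and x y r
  assumes loc: "bilocalised N \<phi>"
    and r: "r = (\<Sum>i\<in>I. tens sP UNIV sP UNIV (x i) (y i))" and inv: "p.poi_invariant r"
begin

lemma bilocalised_add:
  assumes "u \<in> T" "u' \<in> T" "v \<in> T"
  shows "\<phi> (u + u') v = \<phi> u v + \<phi> u' v" "\<phi> v (u + u') = \<phi> v u + \<phi> v u'"
    "\<phi> (u - u') v = \<phi> u v - \<phi> u' v"
proof -
  have \<phi>: "bilinear_on fscale T fscale T (*) \<phi>" using loc by (simp add: bilocalised_def)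
  show "\<phi> (u + u') v = \<phi> u v + \<phi> u' v" "\<phi> v (u + u') = \<phi> v u + \<phi> v u'"
    using \<phi> assms by (simp_all add: bilinear_on_def linear_on_def)
  have "u - u' \<in> T" using assms unfolding tensor_space_def by (intro fvs.span_diff)
  then have "\<phi> (u - u' + u') v = \<phi> (u - u') v + \<phi> u' v"
    using \<phi> assms unfolding bilinear_on_def linear_on_def by blast
  then show "\<phi> (u - u') v = \<phi> u v - \<phi> u' v" by (simp only: diff_add_cancel add_diff_cancel)
qed

lemma bilocalised_minus:
  assumes "u \<in> T" "v \<in> T"
  shows "\<phi> v (- u) = - \<phi> v u"
proof -
  have "\<phi> v (fscale c u) = c * \<phi> v u" for c
    using loc assms by (simp add: bilocalised_def bilinear_on_def linear_on_def)
  from this[of "- 1"] show ?thesis by (simp only: fvs.scale_minus_left fvs.scale_one mult_minus_left mult_1)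
qed

text \<open>Two moves from the second leg to the first: Poi-invariance carries \<open>m\<close> over
  with the sign \<open>k\<close>, and the Casimir identity carries over right multiplication by
  \<open>u\<close>. Later \<open>m\<close> is \<open>mul p\<close> with \<open>k = 1\<close> or
  \<open>br p\<close> with \<open>k = - 1\<close>.\<close>

lemma invariant_sum:
  assumes inv: "\<And>u v. (\<Sum>i\<in>I. \<phi> (tn (x i) u) (tn (m (y i)) v)) = k * (\<Sum>i\<in>I. \<phi> (tn (m (x i)) u) (tn (y i) v))"
  shows "(\<Sum>c\<in>N. \<Sum>i\<in>I. \<phi> (tn (x i) (e c)) (tn (m (y i)) (circB (f c) u)))
    = k * ((\<Sum>c\<in>N. \<Sum>i\<in>I. \<phi> (tn (m (x i)) (circB u (e c))) (tn (y i) (f c)))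
      - (\<Sum>c\<in>N. \<Sum>i\<in>I. \<phi> (tn (m (x i)) (circB (e c) u)) (tn (y i) (f c))))"
proof -
  have "(\<Sum>c\<in>N. \<Sum>i\<in>I. \<phi> (tn (x i) (e c)) (tn (m (y i)) (circB (f c) u)))
      = k * (\<Sum>c\<in>N. \<Sum>i\<in>I. \<phi> (tn (m (x i)) (e c)) (tn (y i) (circB (f c) u)))"
    unfolding inv sum_distrib_left[symmetric] ..
  also have "(\<Sum>c\<in>N. \<Sum>i\<in>I. \<phi> (tn (m (x i)) (e c)) (tn (y i) (circB (f c) u)))
      = (\<Sum>i\<in>I. \<Sum>c\<in>N. \<phi> (tn (m (x i)) (e c)) (tn (y i) (circB (f c) u)))"
    by (rule sum.swap)
  also have "\<dots> = (\<Sum>c\<in>N. \<Sum>i\<in>I. \<phi> (tn (m (x i)) (circB u (e c) - circB (e c) u)) (tn (y i) (f c)))"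
    unfolding bilocalised_casimir(2)[OF loc] by (rule sum.swap)
  finally show ?thesis
    by (simp only: tens_diff_right bilocalised_add(3) tn_in_T sum_subtractf)
qed

text \<open>The sum is additive in \<open>a\<close>, so a pure tensor \<open>tn p u\<close>
  suffices; there \<open>invariant_sum\<close> makes the first summand the negative of the
  commutator in the second.\<close>

lemma circ_invariant_sum:
  assumes "a \<in> T"
  shows "(\<Sum>c\<in>N. \<Sum>i\<in>I. \<phi> (tn (x i) (e c)) (circ (tn (y i) (f c)) a)
    + \<phi> (circ (tn (x i) (e c)) a - circ a (tn (x i) (e c))) (tn (y i) (f c))) = 0" (is "?Z a = 0")
proof -
  have Z_add: "?Z (a + a') = ?Z a + ?Z a'" if "a \<in> T" "a' \<in> T" for a a'
    using that
    by (simp only: product_simps bilocalised_add tn_in_T T_add sum.distrib sum_subtractf)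
      (simp only: algebra_simps)
  show ?thesis
    using vs(1,2) assms
  proof (induction rule: tensor_space_induct)
    case zero
    show ?case using Z_add[OF T_zero T_zero] by (simp only: add_0_left add_cancel_right_right)
  next
    case (add p u a)
    have inv: "(\<Sum>i\<in>I. \<phi> (tn (x i) u) (tn (mul p (y i)) v)) = 1 * (\<Sum>i\<in>I. \<phi> (tn (mul p (x i)) u) (tn (y i) v))"
      for u v
      using poi_invariant_form(1)[OF r inv bilocalised_form(5)[OF loc]] by simp
    have "?Z (tn p u) = 0"
      unfolding circ_tens p.mul_commute[of "x _" p] p.mul_commute[of "y _" p] bilocalised_add(3)[OF tn_in_T tn_in_T tn_in_T]
        sum.distrib sum_subtractf invariant_sum[OF inv]
      by simp
    then show ?case using add Z_add[OF tn_in_T] by simp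
  qed
qed

text \<open>Reduction to pure tensors as for \<open>circ\<close>. Skew-symmetry first turns every
  bracket into \<open>br p\<close>; the sum of left and right multiplication thereby becomes the
  commutator that \<open>invariant_sum\<close> produces.\<close>

lemma ast_invariant_sum:
  assumes "a \<in> T"
  shows "(\<Sum>c\<in>N. \<Sum>i\<in>I. \<phi> (ast a (tn (x i) (e c)) + ast (tn (x i) (e c)) a) (tn (y i) (f c))
    - \<phi> (tn (x i) (e c)) (ast (tn (y i) (f c)) a)) = 0" (is "?Z a = 0")
proof -
  have Z_add: "?Z (a + a') = ?Z a + ?Z a'" if "a \<in> T" "a' \<in> T" for a a'
    using that
    by (simp only: product_simps bilocalised_add tn_in_T T_add sum.distrib sum_subtractf)
      (simp only: algebra_simps)
  show ?thesis
    using vs(1,2) assms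
  proof (induction rule: tensor_space_induct)
    case zero
    show ?case using Z_add[OF T_zero T_zero] by (simp only: add_0_left add_cancel_right_right)
  next
    case (add p u a)
    have inv: "(\<Sum>i\<in>I. \<phi> (tn (x i) u) (tn (br p (y i)) v)) = - 1 * (\<Sum>i\<in>I. \<phi> (tn (br p (x i)) u) (tn (y i) v))"
      for u v
      using poi_invariant_form(2)[OF r inv bilocalised_form(5)[OF loc]] by simp
    have left: "\<phi> (tn (br p q) v + tn (br q p) w) t = \<phi> (tn (br p q) v) t - \<phi> (tn (br p q) w) t"
      and right: "\<phi> t (tn (br q p) w) = - \<phi> t (tn (br p q) w)" if "t \<in> T" for q v w t
      by (simp_all only: br_skew[of q p] tens_minus add_uminus_conv_diff bilocalised_add(3)
          bilocalised_minus tn_in_T that)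
    have "?Z (tn p u) = 0"
      unfolding ast_tens left[OF tn_in_T] right[OF tn_in_T] sum.distrib sum_subtractf sum_negf
        invariant_sum[OF inv]
      by simp
    then show ?case using add Z_add[OF tn_in_T] by simp
  qed
qed

end

text \<open>Invariance passes from any tensor to the element it induces; for claim (ii) this is
  applied to \<open>r + tensor_flip r\<close>.\<close>

theorem induced_r_invariant:
  assumes I: "finite I" and r: "r = (\<Sum>i\<in>I. tens sP UNIV sP UNIV (x i) (y i))"
    and inv: "p.poi_invariant r"
  shows "dpp.dp_invariant (induced_r sP sB G I x y \<Omega> e f)" (is "dpp.dp_invariant ?s")
  unfolding dpp.dp_invariant_def total_eq_T
proof (intro conjI ballI induced_r_in_completed_tensor)
  fix a assume a: "a \<in> T"
  have T_diff: "u \<in> T \<Longrightarrow> v \<in> T \<Longrightarrow> u - v \<in> T" for u v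
    unfolding tensor_space_def by (rule fvs.span_diff)
  have lin: "linear_on fscale T fscale id" "linear_on fscale T fscale (\<lambda>b. circ b a)"
    "linear_on fscale T fscale (\<lambda>b. circ b a - circ a b)" "linear_on fscale T fscale (\<lambda>b. ast b a)"
    "linear_on fscale T fscale (\<lambda>b. ast a b + ast b a)"
    using a dpp.circ_bilinear dpp.ast_bilinear
    by (simp_all add: linear_on_def bilinear_on_def total_eq_T fvs.scale_right_distrib
        fvs.scale_right_diff_distrib del: plus_fun_apply)
  have closed: "id ` T \<subseteq> T" "(\<lambda>b. circ b a) ` T \<subseteq> T" "(\<lambda>b. circ b a - circ a b) ` T \<subseteq> T"
    "(\<lambda>b. ast b a) ` T \<subseteq> T" "(\<lambda>b. ast a b + ast b a) ` T \<subseteq> T"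
    using a by (auto intro!: product_simps T_add T_diff)
  show "gr.completed_map id (\<lambda>b. circ b a) ?s + gr.completed_map (\<lambda>b. circ b a - circ a b) id ?s = 0"
  proof (intro ext)
    fix k l \<phi>
    obtain N where N: "q.saturated N" "\<And>\<phi>. bilinear_on fscale T fscale T (*) \<phi> \<Longrightarrow>
        bilocalised N (\<lambda>u v. \<phi> (gr.component k u) (gr.component l v))"
      using ex_bilocalised[of k l] by blast
    note map = completed_map_induced_r[OF I lin(1) closed(1) lin(2) closed(2) N]
      completed_map_induced_r[OF I lin(3) closed(3) lin(1) closed(1) N]
    show "(gr.completed_map id (\<lambda>b. circ b a) ?s + gr.completed_map (\<lambda>b. circ b a - circ a b) id ?s) k l \<phi>
        = 0 k l \<phi>"
      using circ_invariant_sum[OF N(2) r inv a, of \<phi>] by (simp add: map sum.distrib)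
  qed
  show "gr.completed_map (\<lambda>b. ast a b + ast b a) id ?s - gr.completed_map id (\<lambda>b. ast b a) ?s = 0"
  proof (intro ext)
    fix k l \<phi>
    obtain N where N: "q.saturated N" "\<And>\<phi>. bilinear_on fscale T fscale T (*) \<phi> \<Longrightarrow>
        bilocalised N (\<lambda>u v. \<phi> (gr.component k u) (gr.component l v))"
      using ex_bilocalised[of k l] by blast
    note map = completed_map_induced_r[OF I lin(5) closed(5) lin(1) closed(1) N]
      completed_map_induced_r[OF I lin(1) closed(1) lin(4) closed(4) N]
    show "(gr.completed_map (\<lambda>b. ast a b + ast b a) id ?s - gr.completed_map id (\<lambda>b. ast b a) ?s) k l \<phi>
        = 0 k l \<phi>"
      using ast_invariant_sum[OF N(2) r inv a, of \<phi>] by (simp add: map sum_subtractf)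
  qed
qed

theorem induced_r_skew_part_invariant:
  assumes I: "finite I" and r: "r = (\<Sum>i\<in>I. tens sP UNIV sP UNIV (x i) (y i))"
    and inv: "p.poi_invariant (r + tensor_flip r)"
  shows "dpp.dp_invariant (induced_r sP sB G I x y \<Omega> e f
    - completed_flip (induced_r sP sB G I x y \<Omega> e f))"
proof -
  \<comment> \<open>Writing \<open>r + tensor_flip r\<close> as one sum over the disjoint union of
    two copies of \<open>I\<close> makes it a valid input of \<open>induced_r\<close>.\<close>
  let ?X = "case_sum x y" and ?Y = "case_sum y x"
  have "tensor_flip r = (\<Sum>i\<in>I. tensor_flip (tens sP UNIV sP UNIV (x i) (y i)))"
    unfolding r by (simp add: sum_fun_apply tensor_flip_def fun_eq_iff)
  then have "r + tensor_flip r = (\<Sum>i\<in>I <+> I. tens sP UNIV sP UNIV (?X i) (?Y i))"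
    unfolding r tensor_flip_tens using I by (simp add: sum.Plus comp_def)
  from induced_r_invariant[OF _ this inv]
  have "dpp.dp_invariant (induced_r sP sB G (I <+> I) ?X ?Y \<Omega> e f)" using I by simp
  also have "induced_r sP sB G (I <+> I) ?X ?Y \<Omega> e f
      = induced_r sP sB G I x y \<Omega> e f + induced_r sP sB G I y x \<Omega> e f"
    using I by (intro ext) (simp add: induced_r_def sum.Plus comp_def)
  finally show ?thesis unfolding completed_flip_induced_r diff_minus_eq_add .
qed

end

theorem proposition4p19:
  fixes sP :: "'k::field_char_0 \<Rightarrow> 'p::ab_group_add \<Rightarrow> 'p"
    and mul br :: "'p \<Rightarrow> 'p \<Rightarrow> 'p"
    and sB :: "'k \<Rightarrow> 'b::ab_group_add \<Rightarrow> 'b"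
    and G :: "int \<Rightarrow> 'b set"
    and circB :: "'b \<Rightarrow> 'b \<Rightarrow> 'b"
    and \<omega> :: "'b \<Rightarrow> 'b \<Rightarrow> 'k"
    and I :: "'i set" and x y :: "'i \<Rightarrow> 'p"
    and \<Omega> :: "'j set" and e f :: "'j \<Rightarrow> 'b"
    and r :: "('k, 'p, 'p) tensor"
  assumes P: "poisson_algebra sP mul br"
    and P_fin_dim: "\<exists>F. finite F \<and> module.span sP F = UNIV"
    and B: "quadratic_graded_perm_algebra sB G circB \<omega>"
    and ef: "quadratic_graded_perm_algebra.dual_homogeneous_bases sB G \<omega> \<Omega> e f"
    and I: "finite I"
    and r: "r = (\<Sum>i\<in>I. tens sP UNIV sP UNIV (x i) (y i))"
    and sol: "poisson_algebra.poiybe_solution sP mul br r"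
  shows "let A = induced_grading sP sB G;
             circ = induced_product sP sB mul circB;
             ast = induced_product sP sB br circB;
             rhat = induced_r sP sB G I x y \<Omega> e f
         in graded_dpp_algebra.completed_dpybe_solution fscale A circ ast rhat \<and>
            (tensor_flip r = - r \<longrightarrow> completed_flip rhat = rhat) \<and>
            (poisson_algebra.poi_invariant sP mul br (r + tensor_flip r) \<longrightarrow>
              graded_dpp_algebra.dp_invariant fscale A circ ast (rhat - completed_flip rhat))"
proof -
  \<comment> \<open>The perm algebra enters the locale twice: as the factor of the induced algebra,
    and with its form and dual bases.\<close>
  have "graded_perm_algebra sB G circB"
    using B by (simp add: quadratic_graded_perm_algebra_def)
  then interpret induced_r_setting sP mul br sB G circB \<omega> \<Omega> e f
    using P P_fin_dim B ef
    by (simp add: induced_r_setting_def induced_setting_def induced_setting_axioms_def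
        graded_dual_bases_def graded_dual_bases_axioms_def)
  show ?thesis
    unfolding Let_def
    using induced_r_solution[OF I r sol] induced_r_symmetric[OF r] induced_r_skew_part_invariant[OF I r]
    by blast
qed

end
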